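(* Let $a>b>1$ be fixed and consider the majority dynamics process described in the context, with a fixed initial configuration $y_0$ for each $N$. The following statements hold. (i) (Three updates.) For every fixed $H<\infty$, if $\widetilde\Delta_0\ge -H\frac{N}{\sqrt{\log N}}$, then there exist constants $c_H=c_H(a,b,H)>0$ and $\xi=\xi(a,b)>0$ such that, for all sufficiently large $N$, $$\mathbb P(R_3=\emptyset)\ge 1-2\exp(-c_HN)-2\exp\big(-(\log N)^2\big)-2N^{-\xi}.$$ (ii) (Two updates.) If, for some fixed $K>K_2(a,b)$, $\widetilde\Delta_0\ge K\frac{N}{\sqrt{\log N}}$, then there exists $\xi=\xi(a,b,K)>0$ such that, for all sufficiently large $N$, $$\mathbb P(R_2=\emptyset)\ge 1-2\exp\big(-(\log N)^2\big)-2N^{-\xi}.$$ (iii) (One update.) If, for some fixed $r$ satisfying $0<r<r_*$, $\widetilde\Delta_0\ge [b-(a+b)r]N$, then there exists $\xi=\xi(a,b,r)>0$ such that, for all sufficiently large $N$, $$\mathbb P(R_1=\emptyset)\ge 1-2N^{-\xi}.$$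
   Context: Process. Fix constants $a>b>1$ and put $\alpha=a\log N/N$, $\beta=b\log N/N$ ($N$ large enough that $\alpha\le 1$; natural logarithm). Let $V=[N]=\{1,\dots,N\}$. An opinion configuration is $y_t\in\{\pm1\}^V$, with $B_t=\{v:y_t(v)=+1\}$ (blue) and $R_t=\{v:y_t(v)=-1\}$ (red). For each $N$ the initial configuration $y_0$ is fixed; let $\mathcal F_t=\sigma(y_0,G_1,\dots,G_t)$. Conditionally on $\mathcal F_t$, $G_{t+1}$ is a random graph on $V$ in which each pair $\{u,v\}$, $u\ne v$, is an edge independently with probability $\alpha$ if $y_t(u)=y_t(v)$ and $\beta$ otherwise. All vertices update synchronously: $y_{t+1}(v)=+1$ if $v$ has strictly more $G_{t+1}$-neighbors in $B_t$ than in $R_t$, $y_{t+1}(v)=-1$ if strictly fewer, and $y_{t+1}(v)=y_t(v)$ in case of a tie. The weighted advantage is $\widetilde\Delta_t=b|B_t|-a|R_t|$. Blue unanimity at time $T$ means $R_T=\emptyset$. Constants. $$r_*=r_*(a,b)=\left(\frac{\sqrt{b(a+b-1)}-\sqrt a}{a+b}\right)^2$$ (one has $0<r_*<1/2$). With $\Phi$ the standard normal distribution function, $$K_2(a,b)=\sqrt{\frac{2ab}{a+b}}\;\Phi^{-1}\!\left(1-\frac{a+b}{b}r_*\right).$$ "For all sufficiently large $N$" refers to a hypothesis holding along the sequence $N\to\infty$. *)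

theory Defs
  imports "HOL-Probability.Probability"
begin

definition vertices :: "nat \<Rightarrow> nat set" where
  "vertices N = {1..N}"

text \<open>Opinions are \<open>+1\<close> (blue) and \<open>-1\<close> (red); values outside \<open>vertices N\<close> are irrelevant.\<close>

definition configs :: "nat \<Rightarrow> (nat \<Rightarrow> int) set" where
  "configs N = vertices N \<rightarrow> {-1, 1}"

definition blue :: "nat \<Rightarrow> (nat \<Rightarrow> int) \<Rightarrow> nat set" where
  "blue N y = {v \<in> vertices N. y v = 1}"

definition red :: "nat \<Rightarrow> (nat \<Rightarrow> int) \<Rightarrow> nat set" where
  "red N y = {v \<in> vertices N. y v = -1}"

definition weighted_advantage :: "real \<Rightarrow> real \<Rightarrow> nat \<Rightarrow> (nat \<Rightarrow> int) \<Rightarrow> real" where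
  "weighted_advantage a b N y = b * real (card (blue N y)) - a * real (card (red N y))"

definition vertex_pairs :: "nat \<Rightarrow> nat set set" where
  "vertex_pairs N = {{u, v} |u v. u \<in> vertices N \<and> v \<in> vertices N \<and> u \<noteq> v}"

text \<open>
  A graph on \<open>vertices N\<close> is its set of edges, a subset of \<open>vertex_pairs N\<close>.
  \<open>bernoulli_pmf p\<close> clamps \<open>p\<close> to the unit interval, which has no effect once \<open>N\<close> is so large
  that \<open>a * ln N / N \<le> 1\<close>.
\<close>

definition edge_prob :: "real \<Rightarrow> real \<Rightarrow> nat \<Rightarrow> (nat \<Rightarrow> int) \<Rightarrow> nat set \<Rightarrow> real" where
  "edge_prob a b N y e =
     (if \<forall>u\<in>e. \<forall>v\<in>e. y u = y v then a * ln (real N) / real N else b * ln (real N) / real N)"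

definition random_graph :: "real \<Rightarrow> real \<Rightarrow> nat \<Rightarrow> (nat \<Rightarrow> int) \<Rightarrow> nat set set pmf" where
  "random_graph a b N y =
     map_pmf (\<lambda>f. {e \<in> vertex_pairs N. f e})
       (Pi_pmf (vertex_pairs N) False (\<lambda>e. bernoulli_pmf (edge_prob a b N y e)))"

definition majority_update :: "nat \<Rightarrow> nat set set \<Rightarrow> (nat \<Rightarrow> int) \<Rightarrow> nat \<Rightarrow> int" where
  "majority_update N G y v =
     (let nb = card {u \<in> blue N y. {u, v} \<in> G};
          nr = card {u \<in> red N y. {u, v} \<in> G}
      in if nr < nb then 1 else if nb < nr then -1 else y v)"

text \<open>
  The configuration \<open>y\<^sub>t\<close> is a function of \<open>y\<^sub>0\<close> and the list \<open>[G\<^sub>1, \<dots>, G\<^sub>t]\<close>.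
\<close>

definition opinion :: "nat \<Rightarrow> (nat \<Rightarrow> int) \<Rightarrow> nat set set list \<Rightarrow> nat \<Rightarrow> int" where
  "opinion N y0 Gs = fold (majority_update N) Gs y0"

text \<open>
  The joint law of \<open>[G\<^sub>1, \<dots>, G\<^sub>t]\<close>. The \<open>\<sigma>\<close>-algebra \<open>\<F>\<^sub>t\<close> is generated by this list, so
  conditioning on \<open>\<F>\<^sub>t\<close> amounts to fixing \<open>Gs\<close> in the recursion step.
\<close>

primrec history :: "real \<Rightarrow> real \<Rightarrow> nat \<Rightarrow> (nat \<Rightarrow> int) \<Rightarrow> nat \<Rightarrow> nat set set list pmf" where
  "history a b N y0 0 = return_pmf []"
| "history a b N y0 (Suc t) =
     bind_pmf (history a b N y0 t)
       (\<lambda>Gs. map_pmf (\<lambda>G. Gs @ [G]) (random_graph a b N (opinion N y0 Gs)))"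

definition prob_blue_unanimity :: "real \<Rightarrow> real \<Rightarrow> nat \<Rightarrow> (nat \<Rightarrow> int) \<Rightarrow> nat \<Rightarrow> real" where
  "prob_blue_unanimity a b N y0 T =
     measure_pmf.prob (history a b N y0 T) {Gs. red N (opinion N y0 Gs) = {}}"

definition r_star :: "real \<Rightarrow> real \<Rightarrow> real" where
  "r_star a b = ((sqrt (b * (a + b - 1)) - sqrt a) / (a + b))\<^sup>2"

definition std_normal_cdf :: "real \<Rightarrow> real" where
  "std_normal_cdf = cdf std_normal_distribution"

text \<open>
  For \<open>a > b > 1\<close> the argument of the inverse below lies strictly between 0 and 1, i.e. in the
  range of the injective function \<open>std_normal_cdf\<close>.
\<close>

definition K2 :: "real \<Rightarrow> real \<Rightarrow> real" where
  "K2 a b = sqrt (2 * a * b / (a + b)) * inv std_normal_cdf (1 - (a + b) / b * r_star a b)"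

end

theory Submission
  imports Defs "HOL-Real_Asymp.Real_Asymp"
begin

text \<open>
  The proof analyses one update from a fixed configuration, uniformly over all configurations that
  satisfy a lower bound on the weighted advantage, and then chains at most three such updates.

  For a vertex \<open>v\<close> let \<open>X\<^sub>v\<close> be the number of its red neighbours minus the number of its blue ones.
  If \<open>v\<close> is red after the update, then \<open>X\<^sub>v \<ge> 0\<close>, whatever its previous colour. \<open>X\<^sub>v\<close> is a sum of
  independent Bernoulli variables with weights \<open>\<plusminus>1\<close>, so its law is accessible.

  \<^item> If only \<open>R \<le> r N\<close> vertices are red with \<open>r < r\<^sub>*\<close>, a Chernoff bound at the optimal exponent gives
    \<open>P(X\<^sub>v \<ge> 0) \<le> e N\<^sup>-\<^sup>c\<close>, where \<open>c\<close> is the square of \<open>sqrt (b (1 - r)) - sqrt (a r)\<close>. The constant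
    \<open>r\<^sub>*\<close> is the solution of \<open>c = 1\<close>, so a union bound over the \<open>N\<close> vertices removes all red at once
    (\<open>prob_some_red_after_update\<close>).

  \<^item> If the weighted advantage is at least \<open>K N / sqrt (ln N)\<close>, then for a red vertex \<open>X\<^sub>v\<close> has mean at
    most about \<open>- K sqrt (ln N)\<close>. When the advantage is \<open>o(N)\<close> its variance is about \<open>\<sigma>\<^sup>2 ln N\<close> with
    \<open>\<sigma>\<^sup>2 = 2ab/(a+b)\<close>, and a larger advantage only helps. By a central limit theorem
    the vertex stays red with probability at most about \<open>1 - \<Phi>(K/\<sigma>)\<close>, while a blue vertex, whose mean
    is of order \<open>- ln N\<close>, turns red with probability \<open>o(1)\<close>. Since at most about \<open>b N / (a+b)\<close>
    vertices are red to begin with, the expected number of red vertices after the update is at most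
    about \<open>N b/(a+b) (1 - \<Phi>(K/\<sigma>))\<close>. Flipping one edge changes this number by at most two, so an
    Efron--Stein argument bounds its variance by \<open>O(N ln N)\<close>, and Chebyshev's inequality turns the
    expectation into a high-probability bound (\<open>prob_many_red_after_update\<close>).

  The constant \<open>K2\<close> is the value of \<open>K\<close> for which \<open>b/(a+b) (1 - \<Phi>(K/\<sigma>)) = r\<^sub>*\<close>; above it, one update of the
  second kind followed by one of the first kind gives blue unanimity. For an arbitrary \<open>K = -H\<close> the
  bound \<open>b/(a+b) (1 - \<Phi>(K/\<sigma>))\<close> is still strictly below \<open>b/(a+b)\<close>, the red proportion at which the weighted
  advantage vanishes. So after one update the advantage is of order \<open>N\<close>, which exceeds
  \<open>K' N / sqrt (ln N)\<close> for every \<open>K'\<close>; a second update brings the red proportion below \<open>r\<^sub>*/2\<close> and a third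
  removes red. The last step fails with probability \<open>N\<^sup>-\<^sup>\<xi>\<close> for an exponent
  determined by \<open>a\<close>, \<open>b\<close> and \<open>r\<^sub>*/2\<close>, so \<open>\<xi>\<close> does not depend on \<open>H\<close>.

  Among the error terms of the theorem the polynomial one is the largest. Hence it is enough to
  bound all failure probabilities by powers of \<open>N\<close>.
\<close>

section \<open>Products of Bernoulli laws\<close>

abbreviation bernoulli_product :: "'a set \<Rightarrow> ('a \<Rightarrow> real) \<Rightarrow> ('a \<Rightarrow> bool) pmf" where
  "bernoulli_product E p \<equiv> Pi_pmf E False (\<lambda>e. bernoulli_pmf (p e))"

lemma finite_set_bernoulli_product: "finite E \<Longrightarrow> finite (set_pmf (bernoulli_product E p))"
  by (rule finite_subset[OF set_Pi_pmf_subset']) auto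

lemma integrable_bernoulli_product [simp, intro]:
  fixes F :: "('a \<Rightarrow> bool) \<Rightarrow> 'b :: {banach, second_countable_topology}"
  assumes "finite E"
  shows "integrable (measure_pmf (bernoulli_product E p)) F"
  by (intro integrable_measure_pmf_finite finite_set_bernoulli_product assms)

text \<open>
  Conditioning on one coordinate. This is the induction step for the product formula and for the
  variance bound.
\<close>

lemma expectation_bernoulli_product_insert:
  fixes F :: "('a \<Rightarrow> bool) \<Rightarrow> 'b :: {banach, second_countable_topology}"
  assumes "finite E" "x \<notin> E" "0 \<le> p x" "p x \<le> 1"
  shows "measure_pmf.expectation (bernoulli_product (insert x E) p) F =
    p x *\<^sub>R measure_pmf.expectation (bernoulli_product E p) (\<lambda>f. F (f(x := True))) +
    (1 - p x) *\<^sub>R measure_pmf.expectation (bernoulli_product E p) (\<lambda>f. F (f(x := False)))"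
proof -
  have eq: "bernoulli_product (insert x E) p =
      bernoulli_pmf (p x) \<bind> (\<lambda>b. map_pmf (\<lambda>f. f(x := b)) (bernoulli_product E p))"
    using assms by (subst Pi_pmf_insert') (simp_all add: map_pmf_def)
  show ?thesis
    unfolding eq using assms
    by (subst pmf_expectation_bind[where A = UNIV])
      (auto simp: UNIV_bool finite_set_bernoulli_product)
qed

lemma expectation_bernoulli_product_prod:
  fixes g :: "'a \<Rightarrow> bool \<Rightarrow> 'b :: {real_normed_field, banach, second_countable_topology}"
  assumes "finite E" "\<And>e. e \<in> E \<Longrightarrow> 0 \<le> p e \<and> p e \<le> 1"
  shows "measure_pmf.expectation (bernoulli_product E p) (\<lambda>f. \<Prod>e\<in>E. g e (f e)) =
    (\<Prod>e\<in>E. p e *\<^sub>R g e True + (1 - p e) *\<^sub>R g e False)"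
  using assms
proof (induction E rule: finite_induct)
  case (insert x E)
  have "(\<Prod>e\<in>E. g e ((f(x := b)) e)) = (\<Prod>e\<in>E. g e (f e))" for f b
    using insert.hyps by (intro prod.cong) auto
  then show ?case
    using insert by (simp add: expectation_bernoulli_product_insert algebra_simps)
qed simp

text \<open>
  The Efron--Stein inequality in the form needed here. Averaging over one coordinate \<open>x\<close> replaces \<open>F\<close> by
  \<open>g\<close>, which inherits the bounded differences in the other coordinates. The second moment drops by at most
  \<open>p (1 - p) c\<^sup>2 \<le> p c\<^sup>2\<close>, the variance of a two-valued variable whose values differ by at most \<open>c\<close>. The
  factor \<open>p\<close> is what makes the bound useful for sparse graphs.
\<close>

lemma second_moment_bernoulli_product:
  fixes F :: "('a \<Rightarrow> bool) \<Rightarrow> real"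
  assumes "finite E" "\<And>e. e \<in> E \<Longrightarrow> 0 \<le> p e \<and> p e \<le> 1"
    and "\<And>e f. e \<in> E \<Longrightarrow> \<bar>F (f(e := True)) - F (f(e := False))\<bar> \<le> c"
  shows "measure_pmf.expectation (bernoulli_product E p) (\<lambda>f. (F f)\<^sup>2) \<le>
    (measure_pmf.expectation (bernoulli_product E p) F)\<^sup>2 + c\<^sup>2 * (\<Sum>e\<in>E. p e)"
  using assms
proof (induction E arbitrary: F rule: finite_induct)
  case (insert x E)
  let ?E = "measure_pmf.expectation (bernoulli_product E p)"
  have px: "0 \<le> p x" "p x \<le> 1" using insert.prems by auto
  define g where "g f = p x * F (f(x := True)) + (1 - p x) * F (f(x := False))" for f
  have mean: "measure_pmf.expectation (bernoulli_product (insert x E) p) F = ?E g"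
    using insert.hyps px unfolding g_def by (simp add: expectation_bernoulli_product_insert)
  have pointwise: "p x * (F (f(x := True)))\<^sup>2 + (1 - p x) * (F (f(x := False)))\<^sup>2 \<le> (g f)\<^sup>2 + c\<^sup>2 * p x" for f
  proof -
    have "(F (f(x := True)) - F (f(x := False)))\<^sup>2 \<le> c\<^sup>2"
      using power_mono[OF insert.prems(2)[of x f], of 2] by (simp del: fun_upd_apply)
    then have "(p x * (1 - p x)) * (F (f(x := True)) - F (f(x := False)))\<^sup>2 \<le> p x * c\<^sup>2"
      using px by (intro mult_mono) (auto simp: mult_left_le)
    then show ?thesis
      unfolding g_def by (simp add: power2_eq_square algebra_simps)
  qed
  have diff: "\<bar>g (f(e := True)) - g (f(e := False))\<bar> \<le> c" if "e \<in> E" for e f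
  proof -
    have "e \<noteq> x" using that insert.hyps by auto
    then have tw: "f(e := b, x := b') = f(x := b', e := b)" for b b'
      by (auto simp: fun_eq_iff)
    have d: "\<bar>F (f(x := b, e := True)) - F (f(x := b, e := False))\<bar> \<le> c" for b
      by (rule insert.prems(2)) (use that in auto)
    have "g (f(e := True)) - g (f(e := False)) =
        p x * (F (f(x := True, e := True)) - F (f(x := True, e := False))) +
        (1 - p x) * (F (f(x := False, e := True)) - F (f(x := False, e := False)))"
      unfolding g_def tw by (simp add: algebra_simps)
    also have "\<bar>\<dots>\<bar> \<le> p x * c + (1 - p x) * c"
      using px d by (intro order_trans[OF abs_triangle_ineq] add_mono)
        (auto simp: abs_mult intro!: mult_left_mono)
    finally show ?thesis by (simp add: algebra_simps)
  qed
  have "measure_pmf.expectation (bernoulli_product (insert x E) p) (\<lambda>f. (F f)\<^sup>2) =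
      ?E (\<lambda>f. p x * (F (f(x := True)))\<^sup>2 + (1 - p x) * (F (f(x := False)))\<^sup>2)"
    using insert.hyps px by (simp add: expectation_bernoulli_product_insert)
  also have "\<dots> \<le> ?E (\<lambda>f. (g f)\<^sup>2 + c\<^sup>2 * p x)"
    using insert.hyps pointwise by (intro integral_mono) auto
  also have "\<dots> = ?E (\<lambda>f. (g f)\<^sup>2) + c\<^sup>2 * p x"
    using insert.hyps by simp
  also have "\<dots> \<le> (?E g)\<^sup>2 + c\<^sup>2 * (\<Sum>e\<in>E. p e) + c\<^sup>2 * p x"
    by (intro add_right_mono insert.IH diff) (use insert.prems in auto)
  finally show ?case
    using insert.hyps by (simp add: mean algebra_simps)
qed simp

lemma bernoulli_product_concentration:
  fixes F :: "('a \<Rightarrow> bool) \<Rightarrow> real"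
  assumes "finite E" "\<And>e. e \<in> E \<Longrightarrow> 0 \<le> p e \<and> p e \<le> 1"
    and "\<And>e f. e \<in> E \<Longrightarrow> \<bar>F (f(e := True)) - F (f(e := False))\<bar> \<le> c" and "0 < d"
  shows "measure_pmf.prob (bernoulli_product E p)
      {f. measure_pmf.expectation (bernoulli_product E p) F + d \<le> F f} \<le> c\<^sup>2 * (\<Sum>e\<in>E. p e) / d\<^sup>2"
proof -
  let ?M = "measure_pmf (bernoulli_product E p)"
  have "measure_pmf.prob (bernoulli_product E p) {f. integral\<^sup>L ?M F + d \<le> F f} \<le>
      measure_pmf.prob (bernoulli_product E p) {f \<in> space ?M. d \<le> \<bar>F f - integral\<^sup>L ?M F\<bar>}"
    by (intro measure_pmf.finite_measure_mono) auto
  also have "\<dots> \<le> measure_pmf.variance (bernoulli_product E p) F / d\<^sup>2"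
    using assms by (intro measure_pmf.Chebyshev_inequality) auto
  also have "measure_pmf.variance (bernoulli_product E p) F =
      measure_pmf.expectation (bernoulli_product E p) (\<lambda>f. (F f)\<^sup>2) - (integral\<^sup>L ?M F)\<^sup>2"
    using assms(1) by (intro measure_pmf.variance_eq) auto
  also have "\<dots> \<le> c\<^sup>2 * (\<Sum>e\<in>E. p e)"
    using second_moment_bernoulli_product[where F = F and p = p, OF assms(1-3)] by simp
  finally show ?thesis by (simp add: divide_right_mono)
qed

definition bernoulli_sum :: "'a set \<Rightarrow> ('a \<Rightarrow> real) \<Rightarrow> ('a \<Rightarrow> bool) \<Rightarrow> real" where
  "bernoulli_sum E w f = (\<Sum>e\<in>E. w e * of_bool (f e))"

lemma bernoulli_sum_exp_moment:
  fixes c :: "'b :: {real_normed_field, banach, second_countable_topology}"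
  assumes "finite E" "\<And>e. e \<in> E \<Longrightarrow> 0 \<le> p e \<and> p e \<le> 1"
  shows "measure_pmf.expectation (bernoulli_product E p) (\<lambda>f. exp (c * of_real (bernoulli_sum E w f))) =
    (\<Prod>e\<in>E. 1 + of_real (p e) * (exp (c * of_real (w e)) - 1))"
proof -
  have "exp (c * of_real (bernoulli_sum E w f)) = (\<Prod>e\<in>E. exp (c * of_real (w e * of_bool (f e))))" for f
    unfolding bernoulli_sum_def using assms(1)
    by (simp add: sum_distrib_left exp_sum del: sum_mult_of_bool_eq)
  then show ?thesis
    using expectation_bernoulli_product_prod[where p = p and g = "\<lambda>e b. exp (c * of_real (w e * of_bool b))", OF assms]
    by (simp add: scaleR_conv_of_real algebra_simps)
qed

text \<open>
  Markov's inequality for \<open>exp (c X)\<close>, together with \<open>1 + x \<le> exp x\<close> for each factor. The resulting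
  exponent is that of a compound Poisson variable, which is linear in the probabilities.
\<close>

lemma bernoulli_sum_chernoff:
  assumes "finite E" "\<And>e. e \<in> E \<Longrightarrow> 0 \<le> p e \<and> p e \<le> 1" "0 \<le> c"
  shows "measure_pmf.prob (bernoulli_product E p) {f. 0 \<le> bernoulli_sum E w f} \<le>
    exp (\<Sum>e\<in>E. p e * (exp (c * w e) - 1))"
proof -
  let ?M = "bernoulli_product E p"
  have "measure_pmf.prob ?M {f. 0 \<le> bernoulli_sum E w f} =
      measure_pmf.expectation ?M (indicator {f. 0 \<le> bernoulli_sum E w f})"
    by simp
  also have "\<dots> \<le> measure_pmf.expectation ?M (\<lambda>f. exp (c * bernoulli_sum E w f))"
    using assms by (intro integral_mono) (auto simp: indicator_def)
  also have "\<dots> = (\<Prod>e\<in>E. 1 + p e * (exp (c * w e) - 1))"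
    using bernoulli_sum_exp_moment[where p = p and c = c and w = w, OF assms(1,2)] by simp
  also have "\<dots> \<le> (\<Prod>e\<in>E. exp (p e * (exp (c * w e) - 1)))"
  proof (intro prod_mono conjI)
    fix e assume "e \<in> E"
    then have "0 \<le> p e" "p e \<le> 1" using assms by auto
    then have "0 \<le> (1 - p e) + p e * exp (c * w e)"
      by (intro add_nonneg_nonneg) auto
    then show "0 \<le> 1 + p e * (exp (c * w e) - 1)"
      by (simp add: algebra_simps)
  qed simp
  finally show ?thesis using assms(1) by (simp add: exp_sum)
qed

section \<open>A central limit theorem for triangular arrays of Bernoulli sums\<close>

lemma norm_one_plus_minus_exp_le:
  fixes z :: complex
  assumes "\<bar>Re z\<bar> \<le> 2"
  shows "norm (1 + z - exp z) \<le> exp 2 * (norm z)\<^sup>2"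
proof -
  have "norm (exp z - (\<Sum>k\<le>1. z ^ k / fact k)) \<le> exp \<bar>Re z\<bar> * norm z ^ Suc 1 / fact 1"
    by (rule Taylor_exp)
  then have "norm (1 + z - exp z) \<le> exp \<bar>Re z\<bar> * (norm z)\<^sup>2"
    by (simp add: norm_minus_commute power2_eq_square)
  also have "\<dots> \<le> exp 2 * (norm z)\<^sup>2"
    using assms by (intro mult_right_mono) auto
  finally show ?thesis .
qed

text \<open>
  Poisson approximation on the level of characteristic functions: each factor
  \<open>1 + z\<close> is replaced by \<open>exp z\<close>, at a cost of order \<open>norm z ^ 2\<close>. Since \<open>norm z \<le> p \<bar>\<theta> w\<bar>\<close>, the total
  cost is controlled by the largest \<open>p\<close> times \<open>\<theta>\<^sup>2\<close> times the Poisson variance \<open>\<Sum>p w\<^sup>2\<close>.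
\<close>

lemma bernoulli_sum_char_poisson:
  assumes "finite E" "\<And>e. e \<in> E \<Longrightarrow> 0 \<le> p e \<and> p e \<le> 1" "\<And>e. e \<in> E \<Longrightarrow> p e \<le> d"
  shows "norm (measure_pmf.expectation (bernoulli_product E p) (\<lambda>f. iexp (\<theta> * bernoulli_sum E w f)) -
      exp (\<Sum>e\<in>E. of_real (p e) * (iexp (\<theta> * w e) - 1))) \<le> exp 2 * d * \<theta>\<^sup>2 * (\<Sum>e\<in>E. p e * (w e)\<^sup>2)"
proof -
  define z where "z e = of_real (p e) * (iexp (\<theta> * w e) - 1)" for e
  have Re_z: "Re (z e) \<le> 0" "\<bar>Re (z e)\<bar> \<le> 2" if "e \<in> E" for e
  proof -
    have "Re (z e) = p e * (cos (\<theta> * w e) - 1)"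
      by (simp add: z_def Re_exp)
    moreover have "p e * (1 - cos (\<theta> * w e)) \<le> 1 * 2"
      using assms(2)[OF that] cos_ge_minus_one[of "\<theta> * w e"] by (intro mult_mono) auto
    moreover have "0 \<le> p e * (1 - cos (\<theta> * w e))"
      using assms(2)[OF that] by (intro mult_nonneg_nonneg) auto
    ultimately show "Re (z e) \<le> 0" "\<bar>Re (z e)\<bar> \<le> 2" by (auto simp: algebra_simps)
  qed
  have norm_z: "norm (z e) \<le> p e * \<bar>\<theta> * w e\<bar>" if "e \<in> E" for e
    using iexp_approx1[of "\<theta> * w e" 0] assms(2)[OF that]
    by (auto simp: z_def norm_mult intro!: mult_left_mono)
  have le1: "norm (1 + z e) \<le> 1" if "e \<in> E" for e
  proof -
    have "1 + z e = of_real (1 - p e) + of_real (p e) * iexp (\<theta> * w e)"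
      by (simp add: z_def algebra_simps)
    also have "norm \<dots> \<le> norm (of_real (1 - p e) :: complex) + norm (of_real (p e) * iexp (\<theta> * w e))"
      by (rule norm_triangle_ineq)
    also have "\<dots> \<le> 1"
      using assms(2)[OF that] by (simp add: norm_mult del: of_real_diff)
    finally show ?thesis .
  qed
  have "measure_pmf.expectation (bernoulli_product E p) (\<lambda>f. iexp (\<theta> * bernoulli_sum E w f)) =
      (\<Prod>e\<in>E. 1 + z e)"
    using bernoulli_sum_exp_moment[where p = p and w = w and c = "\<i> * of_real \<theta>", OF assms(1,2)]
    by (simp add: z_def mult.assoc)
  moreover have "exp (\<Sum>e\<in>E. of_real (p e) * (iexp (\<theta> * w e) - 1)) = (\<Prod>e\<in>E. exp (z e))"
    using assms(1) by (simp add: z_def exp_sum)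
  moreover have "norm ((\<Prod>e\<in>E. 1 + z e) - (\<Prod>e\<in>E. exp (z e))) \<le> (\<Sum>e\<in>E. norm (1 + z e - exp (z e)))"
    using le1 Re_z by (intro norm_prod_diff) auto
  moreover have "(\<Sum>e\<in>E. norm (1 + z e - exp (z e))) \<le> (\<Sum>e\<in>E. exp 2 * d * \<theta>\<^sup>2 * (p e * (w e)\<^sup>2))"
  proof (rule sum_mono)
    fix e assume e: "e \<in> E"
    have "norm (1 + z e - exp (z e)) \<le> exp 2 * (norm (z e))\<^sup>2"
      using Re_z[OF e] by (intro norm_one_plus_minus_exp_le)
    also have "\<dots> \<le> exp 2 * (p e * \<bar>\<theta> * w e\<bar>)\<^sup>2"
      using norm_z[OF e] by (intro mult_left_mono power_mono) auto
    also have "(p e * \<bar>\<theta> * w e\<bar>)\<^sup>2 = p e * (p e * (\<theta>\<^sup>2 * (w e)\<^sup>2))"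
      by (simp add: power_mult_distrib power2_eq_square[of "p e"] mult_ac)
    also have "exp 2 * \<dots> \<le> exp 2 * (d * (p e * (\<theta>\<^sup>2 * (w e)\<^sup>2)))"
      using assms(2,3)[OF e] by (intro mult_left_mono mult_right_mono) auto
    finally show "norm (1 + z e - exp (z e)) \<le> exp 2 * d * \<theta>\<^sup>2 * (p e * (w e)\<^sup>2)"
      by (simp add: mult_ac)
  qed
  ultimately show ?thesis by (simp add: sum_distrib_left)
qed

text \<open>
  The exponent of the compound Poisson characteristic function agrees with the Gaussian one up to the
  third-order remainder of the exponential series. The bounded weights turn the third
  absolute moment into the second moment.
\<close>

lemma poisson_exponent_approx:
  assumes "\<And>e. e \<in> E \<Longrightarrow> 0 \<le> p e" "\<And>e. e \<in> E \<Longrightarrow> \<bar>w e\<bar> \<le> 1"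
  shows "norm ((\<Sum>e\<in>E. of_real (p e) * (iexp (\<theta> * w e) - 1)) - \<i> * \<theta> * (\<Sum>e\<in>E. p e * w e)
      + \<theta>\<^sup>2 * (\<Sum>e\<in>E. p e * (w e)\<^sup>2) / 2) \<le> \<bar>\<theta>\<bar> ^ 3 * (\<Sum>e\<in>E. p e * (w e)\<^sup>2)"
proof -
  have "(\<Sum>e\<in>E. of_real (p e) * (iexp (\<theta> * w e) - 1)) - \<i> * \<theta> * (\<Sum>e\<in>E. p e * w e)
      + \<theta>\<^sup>2 * (\<Sum>e\<in>E. p e * (w e)\<^sup>2) / 2 =
    (\<Sum>e\<in>E. of_real (p e) * (iexp (\<theta> * w e) - 1 - \<i> * (\<theta> * w e) + (\<theta> * w e)\<^sup>2 / 2))"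
    by (simp add: sum_distrib_left sum_divide_distrib algebra_simps power_mult_distrib
        flip: sum.distrib sum_subtractf)
  also have "norm \<dots> \<le> (\<Sum>e\<in>E. \<bar>\<theta>\<bar> ^ 3 * (p e * (w e)\<^sup>2))"
  proof (rule sum_norm_le)
    fix e assume e: "e \<in> E"
    have "{..2::nat} = {0, 1, 2}" by auto
    then have "norm (iexp (\<theta> * w e) - 1 - \<i> * (\<theta> * w e) + (\<theta> * w e)\<^sup>2 / 2) \<le> \<bar>\<theta> * w e\<bar> ^ 3 / 6"
      using iexp_approx1[of "\<theta> * w e" 2]
      by (simp add: fact_numeral power_mult_distrib algebra_simps eval_nat_numeral)
    also have "\<dots> \<le> \<bar>\<theta> * w e\<bar> ^ 3"
      by simp
    also have "\<dots> = \<bar>\<theta>\<bar> ^ 3 * (\<bar>w e\<bar>\<^sup>2 * \<bar>w e\<bar>)"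
      by (simp only: abs_mult power_mult_distrib power3_eq_cube power2_eq_square mult_ac)
    also have "\<dots> \<le> \<bar>\<theta>\<bar> ^ 3 * (\<bar>w e\<bar>\<^sup>2 * 1)"
      using assms(2)[OF e] by (intro mult_left_mono) auto
    finally have "p e * norm (iexp (\<theta> * w e) - 1 - \<i> * (\<theta> * w e) + (\<theta> * w e)\<^sup>2 / 2) \<le>
        p e * (\<bar>\<theta>\<bar> ^ 3 * (w e)\<^sup>2)"
      using assms(1)[OF e] by (intro mult_left_mono) auto
    then show "norm (of_real (p e) * (iexp (\<theta> * w e) - 1 - \<i> * (\<theta> * w e) + (\<theta> * w e)\<^sup>2 / 2)) \<le>
        \<bar>\<theta>\<bar> ^ 3 * (p e * (w e)\<^sup>2)"
      using assms(1)[OF e] by (simp add: norm_mult mult_ac)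
  qed
  finally show ?thesis by (simp add: sum_distrib_left)
qed

lemma isCont_std_normal_cdf: "isCont std_normal_cdf x"
proof -
  interpret real_distribution std_normal_distribution by (rule real_dist_normal_dist)
  have "emeasure std_normal_distribution {x} = (\<integral>\<^sup>+ t. std_normal_density t * indicator {x} t \<partial>lborel)"
    by (simp add: emeasure_density)
  also have "\<dots> = (\<integral>\<^sup>+ t. 0 \<partial>(lborel :: real measure))"
    by (intro nn_integral_cong_AE AE_I[of _ _ "{x}"]) (auto simp: indicator_def)
  finally have "measure std_normal_distribution {x} = 0"
    by (simp add: measure_def)
  then show ?thesis
    unfolding std_normal_cdf_def by (simp add: isCont_cdf)
qed

lemma std_normal_cdf_strict_mono: "x < y \<Longrightarrow> std_normal_cdf x < std_normal_cdf y"
proof -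
  assume xy: "x < y"
  interpret real_distribution std_normal_distribution by (rule real_dist_normal_dist)
  have density_pos: "\<not> std_normal_density t \<le> 0" for t
    using normal_density_pos[of 1 0 t] by (simp only: not_le)
  have "emeasure std_normal_distribution {x<..y} \<noteq> 0"
  proof
    assume "emeasure std_normal_distribution {x<..y} = 0"
    then have "(\<integral>\<^sup>+ t. ennreal (std_normal_density t) * indicator {x<..y} t \<partial>lborel) = 0"
      by (simp add: emeasure_density)
    then have "AE t in lborel. ennreal (std_normal_density t) * indicator {x<..y} t = 0"
      by (subst (asm) nn_integral_0_iff_AE) auto
    then have "AE t in lborel. t \<notin> {x<..y}"
      by eventually_elim (auto simp: indicator_def ennreal_eq_0_iff density_pos split: if_splits)
    then have "emeasure lborel {x<..y} = 0"
      by (subst (asm) AE_iff_measurable[of "{x<..y}"]) auto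
    then show False using xy by simp
  qed
  then have "measure std_normal_distribution {x<..y} > 0"
    by (simp add: emeasure_eq_measure zero_less_measure_iff)
  then show ?thesis
    using cdf_diff_eq[OF xy] by (simp add: std_normal_cdf_def)
qed

lemma std_normal_cdf_bounds: "0 \<le> std_normal_cdf x" "std_normal_cdf x \<le> 1"
proof -
  interpret real_distribution std_normal_distribution by (rule real_dist_normal_dist)
  show "0 \<le> std_normal_cdf x" "std_normal_cdf x \<le> 1"
    unfolding std_normal_cdf_def by (auto simp: cdf_nonneg cdf_bounded_prob)
qed

lemma std_normal_cdf_tendsto: "(std_normal_cdf \<longlongrightarrow> 1) at_top" "(std_normal_cdf \<longlongrightarrow> 0) at_bot"
proof -
  interpret real_distribution std_normal_distribution by (rule real_dist_normal_dist)
  show "(std_normal_cdf \<longlongrightarrow> 1) at_top" "(std_normal_cdf \<longlongrightarrow> 0) at_bot"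
    unfolding std_normal_cdf_def by (auto simp: cdf_lim_at_top_prob cdf_lim_at_bot)
qed

text \<open>
  The standard normal distribution function attains every value strictly between 0 and 1, by the
  intermediate value theorem, so the inverse in the definition of \<open>K2\<close> is a genuine one.
\<close>

lemma std_normal_cdf_inv:
  assumes "0 < u" "u < 1"
  shows "std_normal_cdf (inv std_normal_cdf u) = u"
proof -
  have "eventually (\<lambda>x. std_normal_cdf x < u) at_bot" "eventually (\<lambda>x. u < std_normal_cdf x) at_top"
    using std_normal_cdf_tendsto assms by (auto dest: order_tendstoD)
  then obtain l m where lm: "std_normal_cdf l < u" "u < std_normal_cdf m"
    by (auto simp: eventually_at_bot_linorder eventually_at_top_linorder)
  then have "l \<le> m"
    using std_normal_cdf_strict_mono[of m l] by (force simp: not_less[symmetric])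
  then obtain x where "std_normal_cdf x = u"
    using IVT[of std_normal_cdf l u m] lm isCont_std_normal_cdf by force
  then show ?thesis by (intro f_inv_into_f) auto
qed

text \<open>
  The sums are normalised by their Poisson variance \<open>\<Sum>p w\<^sup>2\<close> instead of the exact variance
  \<open>\<Sum>p (1 - p) w\<^sup>2\<close>. The two are asymptotically equal because all probabilities tend to 0, and the
  former fits the Poisson approximation. With \<open>\<theta> = t / s\<close> the two approximation errors are of order
  \<open>d t\<^sup>2\<close> and \<open>\<bar>t\<bar>\<^sup>3 / s\<close>, so the characteristic functions converge and Levy's continuity theorem
  applies.
\<close>

lemma bernoulli_sum_clt:
  fixes E :: "nat \<Rightarrow> 'a set" and p w :: "nat \<Rightarrow> 'a \<Rightarrow> real"
  defines "m \<equiv> \<lambda>n. \<Sum>e\<in>E n. p n e * w n e" and "s \<equiv> \<lambda>n. sqrt (\<Sum>e\<in>E n. p n e * (w n e)\<^sup>2)"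
  assumes fin: "\<And>n. finite (E n)"
    and p: "\<And>n e. e \<in> E n \<Longrightarrow> 0 \<le> p n e \<and> p n e \<le> 1" "\<And>n e. e \<in> E n \<Longrightarrow> p n e \<le> d n"
    and w: "\<And>n e. e \<in> E n \<Longrightarrow> \<bar>w n e\<bar> \<le> 1"
    and d: "d \<longlonglongrightarrow> 0" and s: "filterlim s at_top sequentially"
  shows "weak_conv_m (\<lambda>n. distr (measure_pmf (bernoulli_product (E n) (p n))) borel
      (\<lambda>f. (bernoulli_sum (E n) (w n) f - m n) / s n)) std_normal_distribution"
    (is "weak_conv_m ?D _")
proof (rule levy_continuity)
  show "real_distribution (?D n)" for n
    by (rule prob_space.real_distribution_distr) (auto simp: measure_pmf.prob_space_axioms)
  show "real_distribution std_normal_distribution"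
    by (rule real_dist_normal_dist)
  fix t :: real
  define \<theta> where "\<theta> n = t / s n" for n
  define A where "A n = (\<Sum>e\<in>E n. of_real (p n e) * (iexp (\<theta> n * w n e) - 1)) - \<i> * \<theta> n * m n" for n
  have ev: "\<forall>\<^sub>F n in sequentially. 0 < s n"
    using s by (auto simp: filterlim_at_top_dense)
  have s2: "(\<Sum>e\<in>E n. p n e * (w n e)\<^sup>2) = (s n)\<^sup>2" for n
    unfolding s_def using p by (simp add: sum_nonneg)
  have char_eq: "char (?D n) t = iexp (- (\<theta> n * m n)) *
      measure_pmf.expectation (bernoulli_product (E n) (p n)) (\<lambda>f. iexp (\<theta> n * bernoulli_sum (E n) (w n) f))" for n
  proof -
    have "char (?D n) t = measure_pmf.expectation (bernoulli_product (E n) (p n))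
        (\<lambda>f. iexp (t * ((bernoulli_sum (E n) (w n) f - m n) / s n)))"
      unfolding char_def by (subst integral_distr) auto
    also have "\<dots> = measure_pmf.expectation (bernoulli_product (E n) (p n))
        (\<lambda>f. iexp (- (\<theta> n * m n)) * iexp (\<theta> n * bernoulli_sum (E n) (w n) f))"
      by (intro Bochner_Integration.integral_cong refl)
        (simp add: \<theta>_def algebra_simps diff_divide_distrib flip: exp_add)
    finally show ?thesis by simp
  qed
  have exp_A: "exp (A n) = iexp (- (\<theta> n * m n)) *
      exp (\<Sum>e\<in>E n. of_real (p n e) * (iexp (\<theta> n * w n e) - 1))" for n
    unfolding A_def by (simp add: mult.assoc flip: exp_add)
  have "\<forall>\<^sub>F n in sequentially. norm (A n + t\<^sup>2 / 2) \<le> \<bar>t\<bar> ^ 3 / s n"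
    using ev
  proof eventually_elim
    case (elim n)
    have "(\<theta> n)\<^sup>2 * (s n)\<^sup>2 = t\<^sup>2" "\<bar>\<theta> n\<bar> ^ 3 * (s n)\<^sup>2 = \<bar>t\<bar> ^ 3 / s n"
      using elim by (auto simp: \<theta>_def field_simps power2_eq_square power3_eq_cube)
    then show ?case
      using poisson_exponent_approx[of "E n" "p n" "w n" "\<theta> n"] p w
      unfolding s2 A_def m_def by (simp flip: of_real_power of_real_mult)
  qed
  moreover have "(\<lambda>n. \<bar>t\<bar> ^ 3 / s n) \<longlonglongrightarrow> 0"
    by (intro tendsto_divide_0[OF tendsto_const] filterlim_at_top_imp_at_infinity s)
  ultimately have "(\<lambda>n. A n + t\<^sup>2 / 2) \<longlonglongrightarrow> 0"
    by (rule Lim_null_comparison)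
  then have "A \<longlonglongrightarrow> of_real (- (t\<^sup>2) / 2)"
    by (simp add: LIM_zero_iff[where l = "- ((of_real t)\<^sup>2 / 2)", simplified])
  then have lim: "(\<lambda>n. exp (A n)) \<longlonglongrightarrow> exp (of_real (- (t\<^sup>2) / 2))"
    by (rule tendsto_exp)
  have "\<forall>\<^sub>F n in sequentially. norm (char (?D n) t - exp (A n)) \<le> exp 2 * t\<^sup>2 * d n"
    using ev
  proof eventually_elim
    case (elim n)
    have *: "(\<theta> n)\<^sup>2 * (s n)\<^sup>2 = t\<^sup>2"
      using elim by (auto simp: \<theta>_def field_simps)
    have "norm (char (?D n) t - exp (A n)) =
        norm (iexp (- (\<theta> n * m n)) * (measure_pmf.expectation (bernoulli_product (E n) (p n))
            (\<lambda>f. iexp (\<theta> n * bernoulli_sum (E n) (w n) f))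
          - exp (\<Sum>e\<in>E n. of_real (p n e) * (iexp (\<theta> n * w n e) - 1))))"
      unfolding char_eq exp_A by (simp only: right_diff_distrib)
    also have "\<dots> \<le> exp 2 * d n * ((\<theta> n)\<^sup>2 * (s n)\<^sup>2)"
      using bernoulli_sum_char_poisson[of "E n" "p n" "d n" "\<theta> n" "w n"] fin p
      unfolding norm_mult norm_exp_i_times s2 by simp
    finally show ?case by (simp add: * mult_ac)
  qed
  moreover have "(\<lambda>n. exp 2 * t\<^sup>2 * d n) \<longlonglongrightarrow> 0"
    using tendsto_mult_right_zero[OF d] by simp
  ultimately have "(\<lambda>n. char (?D n) t - exp (A n)) \<longlonglongrightarrow> 0"
    by (rule Lim_null_comparison)
  from tendsto_add[OF this lim] show "(\<lambda>n. char (?D n) t) \<longlonglongrightarrow> char std_normal_distribution t"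
    by (simp add: char_std_normal_distribution flip: exp_of_real)
qed

text \<open>
  A uniform version of the central limit theorem without sequences: a Bernoulli sum whose mean lies
  below 0 by at least \<open>x\<close> times the root of its Poisson variance is nonnegative with probability at most about \<open>1 - \<Phi>(x)\<close>, as soon
  as the probabilities are small and the variance is large. The single parameter \<open>M\<close> controls both. If
  the claim failed, counterexamples for \<open>M = 1, 2, 3, \<dots>\<close> would form an array to which the central limit
  theorem applies.
\<close>

lemma bernoulli_sum_tail_le:
  fixes x q :: real
  assumes q: "1 - std_normal_cdf x < q"
  shows "\<exists>M>0. \<forall>(E :: 'a set) p w. finite E \<longrightarrow>
    (\<forall>e\<in>E. 0 \<le> p e \<and> p e \<le> 1 \<and> p e \<le> 1 / M \<and> \<bar>w e\<bar> \<le> 1) \<longrightarrow>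
    M \<le> (\<Sum>e\<in>E. p e * (w e)\<^sup>2) \<longrightarrow>
    x * sqrt (\<Sum>e\<in>E. p e * (w e)\<^sup>2) \<le> - (\<Sum>e\<in>E. p e * w e) \<longrightarrow>
    measure_pmf.prob (bernoulli_product E p) {f. 0 \<le> bernoulli_sum E w f} \<le> q"
proof (rule ccontr)
  define bad where "bad M E p w \<longleftrightarrow> finite E \<and>
    (\<forall>e\<in>E. 0 \<le> p e \<and> p e \<le> 1 \<and> p e \<le> 1 / M \<and> \<bar>w e\<bar> \<le> 1) \<and>
    M \<le> (\<Sum>e\<in>E. p e * (w e)\<^sup>2) \<and>
    x * sqrt (\<Sum>e\<in>E. p e * (w e)\<^sup>2) \<le> - (\<Sum>e\<in>E. p e * w e) \<and>
    q < measure_pmf.prob (bernoulli_product E p) {f. 0 \<le> bernoulli_sum E w f}"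
    for M :: real and E :: "'a set" and p w
  assume "\<not> ?thesis"
  then have "\<exists>E p w. bad M E p w" if "0 < M" for M
    using that unfolding bad_def by (simp add: not_le)
  then have "\<forall>n. \<exists>E p w. bad (real (Suc n)) E p w"
    by (auto simp del: of_nat_Suc)
  then obtain E p w where "\<And>n. bad (real (Suc n)) (E n) (p n) (w n)"
    by metis
  then have fin: "\<And>n. finite (E n)"
    and p: "\<And>n e. e \<in> E n \<Longrightarrow> 0 \<le> p n e \<and> p n e \<le> 1" "\<And>n e. e \<in> E n \<Longrightarrow> p n e \<le> 1 / real (Suc n)"
    and w: "\<And>n e. e \<in> E n \<Longrightarrow> \<bar>w n e\<bar> \<le> 1"
    and var: "\<And>n. real (Suc n) \<le> (\<Sum>e\<in>E n. p n e * (w n e)\<^sup>2)"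
    and drift: "\<And>n. x * sqrt (\<Sum>e\<in>E n. p n e * (w n e)\<^sup>2) \<le> - (\<Sum>e\<in>E n. p n e * w n e)"
    and prob: "\<And>n. q < measure_pmf.prob (bernoulli_product (E n) (p n)) {f. 0 \<le> bernoulli_sum (E n) (w n) f}"
    unfolding bad_def by blast+
  define m where "m n = (\<Sum>e\<in>E n. p n e * w n e)" for n
  define s where "s n = sqrt (\<Sum>e\<in>E n. p n e * (w n e)\<^sup>2)" for n
  define D where "D n = distr (measure_pmf (bernoulli_product (E n) (p n))) borel
      (\<lambda>f. (bernoulli_sum (E n) (w n) f - m n) / s n)" for n
  have s_ge: "sqrt (real (Suc n)) \<le> s n" for n
    unfolding s_def using var by (intro real_sqrt_le_mono)
  have s_pos: "0 < s n" for n
    by (rule less_le_trans[OF _ s_ge]) auto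
  have "filterlim s at_top sequentially"
    by (rule filterlim_at_top_mono[OF _ always_eventually[OF allI[OF s_ge]]])
      (rule filterlim_compose[OF sqrt_at_top filterlim_compose[OF filterlim_real_sequentially filterlim_Suc]])
  moreover have "(\<lambda>n. 1 / real (Suc n)) \<longlonglongrightarrow> 0"
    using LIMSEQ_Suc[OF lim_1_over_n] by simp
  ultimately have conv: "weak_conv_m D std_normal_distribution"
    unfolding D_def m_def s_def using fin p w
    by (intro bernoulli_sum_clt[where d = "\<lambda>n. 1 / real (Suc n)"]) (auto simp: s_def[abs_def])
  have "(std_normal_cdf \<longlongrightarrow> std_normal_cdf x) (at_left x)"
    using isCont_std_normal_cdf by (auto simp: isCont_def intro: tendsto_within_subset)
  then have "\<forall>\<^sub>F x' in at_left x. 1 - q < std_normal_cdf x'"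
    using q by (intro order_tendstoD(1)) auto
  moreover have "\<forall>\<^sub>F x' in at_left x. x' < x"
    by (auto simp: eventually_at_filter)
  ultimately have "\<forall>\<^sub>F x' in at_left x. x' < x \<and> 1 - q < std_normal_cdf x'"
    by eventually_elim auto
  \<comment> \<open>The event is an open half-line in terms of the normalised sum, while distribution functions measure closed ones; \<open>x' < x\<close> separates the two.\<close>
  then obtain x' where x': "x' < x" "1 - q < std_normal_cdf x'"
    using eventually_happens'[OF trivial_limit_at_left_real] by blast
  have "(\<lambda>n. cdf (D n) x') \<longlonglongrightarrow> std_normal_cdf x'"
    using conv isCont_std_normal_cdf by (auto simp: weak_conv_m_def weak_conv_def std_normal_cdf_def)
  then have "\<forall>\<^sub>F n in sequentially. 1 - q < cdf (D n) x'"
    using x' by (intro order_tendstoD(1))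
  then obtain n where n: "1 - q < cdf (D n) x'"
    using eventually_happens'[OF sequentially_bot] by blast
  let ?P = "measure_pmf.prob (bernoulli_product (E n) (p n))"
  have "cdf (D n) x' = ?P {f. (bernoulli_sum (E n) (w n) f - m n) / s n \<le> x'}"
    unfolding cdf_def D_def by (subst measure_distr) (auto simp: vimage_def)
  also have "\<dots> \<le> ?P (- {f. 0 \<le> bernoulli_sum (E n) (w n) f})"
  proof (intro measure_pmf.finite_measure_mono subsetI)
    fix f assume "f \<in> {f. (bernoulli_sum (E n) (w n) f - m n) / s n \<le> x'}"
    then have "bernoulli_sum (E n) (w n) f \<le> m n + x' * s n"
      using s_pos[of n] by (simp add: field_simps)
    also have "\<dots> < m n + x * s n"
      using x' s_pos[of n] by simp
    also have "\<dots> \<le> 0"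
      using drift[of n] by (simp add: m_def s_def)
    finally show "f \<in> - {f. 0 \<le> bernoulli_sum (E n) (w n) f}" by simp
  qed auto
  also have "\<dots> = 1 - ?P {f. 0 \<le> bernoulli_sum (E n) (w n) f}"
    using measure_pmf.prob_compl[of "{f. 0 \<le> bernoulli_sum (E n) (w n) f}" "bernoulli_product (E n) (p n)"]
    by (simp add: Compl_eq_Diff_UNIV)
  finally show False using n prob[of n] by linarith
qed

section \<open>One update of the majority dynamics\<close>

lemma finite_vertices [simp]: "finite (vertices N)"
  by (simp add: vertices_def)

lemma vertex_pairs_subset: "vertex_pairs N \<subseteq> (\<lambda>(u, v). {u, v}) ` (vertices N \<times> vertices N)"
  by (force simp: vertex_pairs_def)

lemma finite_vertex_pairs [simp]: "finite (vertex_pairs N)"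
  by (rule finite_subset[OF vertex_pairs_subset]) simp

lemma card_vertex_pairs_le: "card (vertex_pairs N) \<le> N\<^sup>2"
proof -
  have "card (vertex_pairs N) \<le> card ((\<lambda>(u, v). {u, v}) ` (vertices N \<times> vertices N))"
    by (intro card_mono vertex_pairs_subset) simp
  also have "\<dots> \<le> card (vertices N \<times> vertices N)"
    by (rule card_image_le) simp
  finally show ?thesis by (simp add: vertices_def power2_eq_square)
qed

lemma sum_vertex_pairs_at:
  fixes h :: "nat set \<Rightarrow> real"
  assumes v: "v \<in> vertices N" and h: "\<And>e. v \<notin> e \<Longrightarrow> h e = 0"
  shows "(\<Sum>e\<in>vertex_pairs N. h e) = (\<Sum>u\<in>vertices N - {v}. h {u, v})"
proof -
  have "(\<Sum>e\<in>vertex_pairs N. h e) = (\<Sum>e\<in>(\<lambda>u. {u, v}) ` (vertices N - {v}). h e)"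
  proof (rule sum.mono_neutral_right)
    show "(\<lambda>u. {u, v}) ` (vertices N - {v}) \<subseteq> vertex_pairs N"
      using v by (force simp: vertex_pairs_def)
    show "\<forall>e\<in>vertex_pairs N - (\<lambda>u. {u, v}) ` (vertices N - {v}). h e = 0"
    proof
      fix e assume e: "e \<in> vertex_pairs N - (\<lambda>u. {u, v}) ` (vertices N - {v})"
      then obtain u w where uw: "e = {u, w}" "u \<in> vertices N" "w \<in> vertices N" "u \<noteq> w"
        by (force simp: vertex_pairs_def)
      moreover have "{v, w} = {w, v}" by (rule insert_commute)
      ultimately have "v \<noteq> u" "v \<noteq> w" using e by blast+
      then show "h e = 0" using uw by (intro h) auto
    qed
  qed simp
  also have "\<dots> = (\<Sum>u\<in>vertices N - {v}. h {u, v})"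
    by (subst sum.reindex) (auto simp: inj_on_def doubleton_eq_iff)
  finally show ?thesis .
qed

lemma doubleton_in_vertex_pairs:
  assumes "u \<in> vertices N" "v \<in> vertices N"
  shows "{u, v} \<in> vertex_pairs N \<longleftrightarrow> u \<noteq> v"
proof
  assume "{u, v} \<in> vertex_pairs N"
  then obtain x w where "{u, v} = {x, w}" "x \<noteq> w"
    by (force simp: vertex_pairs_def)
  then show "u \<noteq> v" by (simp add: doubleton_eq_iff) blast
next
  assume "u \<noteq> v"
  then show "{u, v} \<in> vertex_pairs N" using assms unfolding vertex_pairs_def by blast
qed

lemma finite_blue [simp]: "finite (blue N y)" and finite_red [simp]: "finite (red N y)"
  by (auto simp: blue_def red_def)

lemma vertices_eq_blue_Un_red: "y \<in> configs N \<Longrightarrow> vertices N = blue N y \<union> red N y"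
  by (auto simp: configs_def blue_def red_def)

lemma card_blue_add_card_red:
  assumes "y \<in> configs N"
  shows "card (blue N y) + card (red N y) = N"
proof -
  have "card (blue N y \<union> red N y) = card (blue N y) + card (red N y)"
    by (intro card_Un_disjoint) (auto simp: blue_def red_def)
  moreover have "card (vertices N) = N"
    by (simp add: vertices_def)
  ultimately show ?thesis
    by (simp flip: vertices_eq_blue_Un_red[OF assms])
qed

lemma sum_other_vertices:
  fixes g :: "nat \<Rightarrow> real"
  assumes "y \<in> configs N"
  shows "(\<Sum>u\<in>vertices N - {v}. g u) = (\<Sum>u\<in>blue N y - {v}. g u) + (\<Sum>u\<in>red N y - {v}. g u)"
  unfolding vertices_eq_blue_Un_red[OF assms] Un_Diff
  by (intro sum.union_disjoint) (auto simp: blue_def red_def)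

text \<open>
  The contribution of the edge \<open>e\<close> to the number of red minus blue neighbours of \<open>v\<close>: the negated opinion
  of the other endpoint of \<open>e\<close>, written as a sum over the singleton \<open>e - {v}\<close>.
\<close>

definition pull :: "(nat \<Rightarrow> int) \<Rightarrow> nat \<Rightarrow> nat set \<Rightarrow> real" where
  "pull y v e = (if v \<in> e then - real_of_int (\<Sum>u\<in>e - {v}. y u) else 0)"

lemma pull_eq_0 [simp]: "v \<notin> e \<Longrightarrow> pull y v e = 0"
  by (simp add: pull_def)

lemma pull_doubleton: "u \<noteq> v \<Longrightarrow> pull y v {u, v} = - real_of_int (y u)"
proof -
  assume "u \<noteq> v"
  then have "{u, v} - {v} = {u}" by auto
  then show ?thesis by (simp add: pull_def)
qed

lemma abs_pull_le:
  assumes y: "y \<in> configs N" and e: "e \<in> vertex_pairs N"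
  shows "\<bar>pull y v e\<bar> \<le> 1"
proof -
  have abs_y: "\<bar>real_of_int (y u)\<bar> \<le> 1" if "u \<in> vertices N" for u
    using y that by (force simp: configs_def Pi_iff)
  from e obtain u w where uw: "e = {u, w}" "u \<in> vertices N" "w \<in> vertices N" "u \<noteq> w"
    by (force simp: vertex_pairs_def)
  consider "v = u" | "v = w" | "v \<notin> e" using uw by blast
  then show ?thesis
  proof cases
    case 1
    then show ?thesis using uw abs_y pull_doubleton[of w v y] by (simp add: insert_commute)
  next
    case 2
    then show ?thesis using uw abs_y pull_doubleton[of u v y] by simp
  qed simp
qed

lemma bernoulli_sum_pull:
  assumes y: "y \<in> configs N" and v: "v \<in> vertices N"
  defines "G \<equiv> \<lambda>f. {e \<in> vertex_pairs N. f e}"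
  shows "bernoulli_sum (vertex_pairs N) (pull y v) f =
    real (card {u \<in> red N y. {u, v} \<in> G f}) - real (card {u \<in> blue N y. {u, v} \<in> G f})"
proof -
  have *: "(\<Sum>u\<in>A - {v}. of_bool (f {u, v}) :: real) = real (card {u \<in> A. {u, v} \<in> G f})"
    if "A \<subseteq> vertices N" for A
  proof -
    have "finite A" using that by (rule finite_subset) simp
    have pair: "{u, v} \<in> vertex_pairs N \<longleftrightarrow> u \<noteq> v" if "u \<in> vertices N" for u
      using that v by (rule doubleton_in_vertex_pairs)
    have "{u \<in> A. {u, v} \<in> G f} = (A - {v}) \<inter> {u. f {u, v}}"
      using that pair by (auto simp: G_def)
    then show ?thesis using \<open>finite A\<close> by simp
  qed
  have "bernoulli_sum (vertex_pairs N) (pull y v) f =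
      (\<Sum>u\<in>vertices N - {v}. pull y v {u, v} * of_bool (f {u, v}))"
    unfolding bernoulli_sum_def using v by (rule sum_vertex_pairs_at) simp
  also have "\<dots> = (\<Sum>u\<in>vertices N - {v}. - real_of_int (y u) * of_bool (f {u, v}))"
    by (intro sum.cong) (auto simp: pull_doubleton)
  also have "\<dots> = (\<Sum>u\<in>blue N y - {v}. - of_bool (f {u, v})) + (\<Sum>u\<in>red N y - {v}. of_bool (f {u, v}))"
    unfolding sum_other_vertices[OF y]
    by (intro arg_cong2[of _ _ _ _ "(+)"] sum.cong) (auto simp: blue_def red_def)
  also have "\<dots> = real (card {u \<in> red N y. {u, v} \<in> G f}) - real (card {u \<in> blue N y. {u, v} \<in> G f})"
    using *[of "red N y"] *[of "blue N y"]
    by (simp add: sum_negf blue_def red_def del: sum_of_bool_eq)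
  finally show ?thesis .
qed

text \<open>
  A vertex that is red after the update has at least as many red as blue neighbours: this covers both
  a red majority and a tie that leaves a red vertex unchanged. Treating both colours by the same event
  loses only ties at blue vertices.
\<close>

lemma red_after_update_imp:
  assumes y: "y \<in> configs N" and v: "v \<in> red N (majority_update N {e \<in> vertex_pairs N. f e} y)"
  shows "0 \<le> bernoulli_sum (vertex_pairs N) (pull y v) f"
proof -
  define G where "G = {e \<in> vertex_pairs N. f e}"
  have "v \<in> vertices N" "majority_update N G y v = -1"
    using v unfolding red_def[of _ "majority_update _ _ _"] G_def by blast+
  then have "\<not> card {u \<in> red N y. {u, v} \<in> G} < card {u \<in> blue N y. {u, v} \<in> G}"
    by (intro notI) (simp add: majority_update_def)
  then show ?thesis
    unfolding bernoulli_sum_pull[OF y \<open>v \<in> vertices N\<close>] G_def by linarith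
qed

lemma edge_prob_doubleton:
  "edge_prob a b N y {u, v} = (if y u = y v then a else b) * ln (real N) / real N"
proof -
  have *: "(\<forall>x\<in>{u, v}. \<forall>z\<in>{u, v}. y x = y z) \<longleftrightarrow> y u = y v"
    by (metis insert_iff singletonD)
  show ?thesis unfolding edge_prob_def * by (cases "y u = y v") simp_all
qed

text \<open>
  The mean, the variance proxy and the exponential moments of the pull at \<open>v\<close> are all sums of this form,
  for \<open>h\<close> the identity, the square and \<open>t \<mapsto> exp (c t) - 1\<close>. The summand \<open>-1\<close> accounts for \<open>v\<close> not being
  its own neighbour.
\<close>

lemma sum_edge_prob_pull:
  assumes y: "y \<in> configs N" and v: "v \<in> vertices N" and h: "h 0 = 0"
  shows "(\<Sum>e\<in>vertex_pairs N. edge_prob a b N y e * h (pull y v e)) =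
    (if v \<in> red N y
     then (b * card (blue N y) * h (-1) + a * (real (card (red N y)) - 1) * h 1) * ln (real N) / real N
     else (a * (real (card (blue N y)) - 1) * h (-1) + b * card (red N y) * h 1) * ln (real N) / real N)"
proof -
  define q where "q u = edge_prob a b N y {u, v} * h (- real_of_int (y u))" for u
  have card_Diff: "real (card (A - {v})) = real (card A) - 1" if "finite A" "v \<in> A" for A
  proof -
    have "card A > 0" using that by (auto simp: card_gt_0_iff)
    then show ?thesis using that by (simp add: card_Diff_singleton)
  qed
  have "(\<Sum>e\<in>vertex_pairs N. edge_prob a b N y e * h (pull y v e)) =
      (\<Sum>u\<in>vertices N - {v}. edge_prob a b N y {u, v} * h (pull y v {u, v}))"
    using v by (rule sum_vertex_pairs_at) (simp add: h)
  also have "\<dots> = (\<Sum>u\<in>vertices N - {v}. q u)"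
    by (intro sum.cong) (auto simp: pull_doubleton q_def)
  also have "\<dots> = (\<Sum>u\<in>blue N y - {v}. q u) + (\<Sum>u\<in>red N y - {v}. q u)"
    by (rule sum_other_vertices[OF y])
  finally have eq: "(\<Sum>e\<in>vertex_pairs N. edge_prob a b N y e * h (pull y v e)) =
      (\<Sum>u\<in>blue N y - {v}. q u) + (\<Sum>u\<in>red N y - {v}. q u)" .
  define L where "L = ln (real N) / real N"
  show ?thesis
  proof (cases "v \<in> red N y")
    case True
    then have "v \<notin> blue N y" "y v = -1" by (auto simp: red_def blue_def)
    have "(\<Sum>u\<in>blue N y - {v}. q u) = (\<Sum>u\<in>blue N y - {v}. b * L * h (-1))"
      using \<open>y v = -1\<close> by (intro sum.cong) (auto simp: q_def edge_prob_doubleton blue_def L_def)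
    also have "\<dots> = real (card (blue N y)) * (b * L * h (-1))"
      unfolding Diff_insert0[OF \<open>v \<notin> blue N y\<close>] Diff_empty by (rule sum_constant)
    finally have 1: "(\<Sum>u\<in>blue N y - {v}. q u) = real (card (blue N y)) * (b * L * h (-1))" .
    have "(\<Sum>u\<in>red N y - {v}. q u) = (\<Sum>u\<in>red N y - {v}. a * L * h 1)"
      using \<open>y v = -1\<close> by (intro sum.cong) (auto simp: q_def edge_prob_doubleton red_def L_def)
    also have "\<dots> = (real (card (red N y)) - 1) * (a * L * h 1)"
      using True by (simp only: sum_constant card_Diff[OF finite_red])
    finally have "(\<Sum>e\<in>vertex_pairs N. edge_prob a b N y e * h (pull y v e)) =
        real (card (blue N y)) * (b * L * h (-1)) + (real (card (red N y)) - 1) * (a * L * h 1)"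
      by (simp only: eq 1)
    also have "\<dots> = (b * card (blue N y) * h (-1) + a * (real (card (red N y)) - 1) * h 1) * L"
      by (simp only: algebra_simps)
    also have "\<dots> = (b * card (blue N y) * h (-1) + a * (real (card (red N y)) - 1) * h 1) * ln (real N) / real N"
      by (simp only: L_def times_divide_eq_right)
    finally show ?thesis unfolding if_P[OF True] .
  next
    case False
    then have "v \<in> blue N y"
      using v vertices_eq_blue_Un_red[OF y] by blast
    then have "y v = 1" by (simp add: blue_def)
    have "(\<Sum>u\<in>blue N y - {v}. q u) = (\<Sum>u\<in>blue N y - {v}. a * L * h (-1))"
      using \<open>y v = 1\<close> by (intro sum.cong) (auto simp: q_def edge_prob_doubleton blue_def L_def)
    also have "\<dots> = (real (card (blue N y)) - 1) * (a * L * h (-1))"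
      using \<open>v \<in> blue N y\<close> by (simp only: sum_constant card_Diff[OF finite_blue])
    finally have 1: "(\<Sum>u\<in>blue N y - {v}. q u) = (real (card (blue N y)) - 1) * (a * L * h (-1))" .
    have "(\<Sum>u\<in>red N y - {v}. q u) = (\<Sum>u\<in>red N y - {v}. b * L * h 1)"
      using \<open>y v = 1\<close> by (intro sum.cong) (auto simp: q_def edge_prob_doubleton red_def L_def)
    also have "\<dots> = real (card (red N y)) * (b * L * h 1)"
      unfolding Diff_insert0[OF False] Diff_empty by (rule sum_constant)
    finally have "(\<Sum>e\<in>vertex_pairs N. edge_prob a b N y e * h (pull y v e)) =
        (real (card (blue N y)) - 1) * (a * L * h (-1)) + real (card (red N y)) * (b * L * h 1)"
      by (simp only: eq 1)
    also have "\<dots> = (a * (real (card (blue N y)) - 1) * h (-1) + b * card (red N y) * h 1) * L"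
      by (simp only: algebra_simps)
    also have "\<dots> = (a * (real (card (blue N y)) - 1) * h (-1) + b * card (red N y) * h 1) * ln (real N) / real N"
      by (simp only: L_def times_divide_eq_right)
    finally show ?thesis unfolding if_not_P[OF False] .
  qed
qed

lemma edge_prob_bounds:
  assumes "0 \<le> b" "b \<le> a" "1 \<le> N"
  shows "0 \<le> edge_prob a b N y e" "edge_prob a b N y e \<le> a * ln N / N"
proof -
  have "edge_prob a b N y e = a * ln N / N \<or> edge_prob a b N y e = b * ln N / N"
    unfolding edge_prob_def by (split if_split) blast
  moreover have "0 \<le> b * ln N / N" "b * ln N / N \<le> a * ln N / N"
    using assms by (auto intro!: divide_right_mono mult_right_mono)
  ultimately show "0 \<le> edge_prob a b N y e" "edge_prob a b N y e \<le> a * ln N / N"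
    by linarith+
qed

lemma prob_random_graph:
  "measure_pmf.prob (random_graph a b N y) {G. P G} =
   measure_pmf.prob (bernoulli_product (vertex_pairs N) (edge_prob a b N y)) {f. P {e \<in> vertex_pairs N. f e}}"
  by (simp add: random_graph_def vimage_def)

definition red_count :: "nat \<Rightarrow> (nat \<Rightarrow> int) \<Rightarrow> (nat set \<Rightarrow> bool) \<Rightarrow> real" where
  "red_count N y f = real (card (red N (majority_update N {e \<in> vertex_pairs N. f e} y)))"

text \<open>
  Changing the status of one edge affects only the neighbourhoods of its two endpoints.
\<close>

lemma red_count_bounded_difference:
  assumes "e \<in> vertex_pairs N"
  shows "\<bar>red_count N y (f(e := True)) - red_count N y (f(e := False))\<bar> \<le> 2"
proof -
  define upd where "upd c = majority_update N {e' \<in> vertex_pairs N. (f(e := c)) e'} y" for c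
  define P where "P c = red N (upd c)" for c
  have fin: "finite (P c)" for c by (simp add: P_def)
  have e: "finite e" "card e \<le> 2"
    using assms by (auto simp: vertex_pairs_def card_insert_if)
  have upd_eq: "upd c v = upd c' v" if "v \<notin> e" for c c' v
  proof -
    have "{u, v} \<noteq> e" for u using that by auto
    then show ?thesis by (simp add: upd_def majority_update_def)
  qed
  have "P c - e = P c' - e" for c c'
    using upd_eq[of _ c c'] by (auto simp: P_def red_def)
  then have "card (P c) \<le> card (P c') + 2" for c c'
  proof -
    have "card (P c) \<le> card ((P c - e) \<union> e)"
      using fin e by (intro card_mono) auto
    also have "\<dots> \<le> card (P c - e) + card e" by (rule card_Un_le)
    also have "P c - e = P c' - e" by fact
    also have "card (P c' - e) \<le> card (P c')"
      using fin by (intro card_mono) auto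
    finally show ?thesis using e by simp
  qed
  from this[of True False] this[of False True] show ?thesis
    by (simp add: red_count_def P_def upd_def)
qed

lemma expectation_red_count_le:
  assumes y: "y \<in> configs N"
    and c: "\<And>v. v \<in> vertices N \<Longrightarrow>
      measure_pmf.prob (bernoulli_product (vertex_pairs N) p) {f. 0 \<le> bernoulli_sum (vertex_pairs N) (pull y v) f} \<le> c v"
  shows "measure_pmf.expectation (bernoulli_product (vertex_pairs N) p) (red_count N y) \<le> (\<Sum>v\<in>vertices N. c v)"
proof -
  let ?M = "bernoulli_product (vertex_pairs N) p"
  let ?A = "\<lambda>v. {f. 0 \<le> bernoulli_sum (vertex_pairs N) (pull y v) f}"
  have "red_count N y f \<le> (\<Sum>v\<in>vertices N. indicator (?A v) f)" for f
  proof -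
    have "red N (majority_update N {e \<in> vertex_pairs N. f e} y) \<subseteq> {v \<in> vertices N. f \<in> ?A v}"
      using red_after_update_imp[OF y] by (auto simp: red_def)
    from card_mono[OF _ this] have "red_count N y f \<le> real (card {v \<in> vertices N. f \<in> ?A v})"
      by (simp add: red_count_def)
    also have "\<dots> = (\<Sum>v\<in>vertices N. indicator (?A v) f)"
      by (simp add: indicator_def Int_def)
    finally show ?thesis .
  qed
  then have "measure_pmf.expectation ?M (red_count N y) \<le>
      measure_pmf.expectation ?M (\<lambda>f. \<Sum>v\<in>vertices N. indicator (?A v) f)"
    by (intro integral_mono) auto
  also have "\<dots> = (\<Sum>v\<in>vertices N. measure_pmf.prob ?M (?A v))"
    by (subst Bochner_Integration.integral_sum) auto
  also have "\<dots> \<le> (\<Sum>v\<in>vertices N. c v)"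
    by (intro sum_mono c)
  finally show ?thesis .
qed

section \<open>Drift against fluctuation\<close>

lemma eventually_ln_ge: "\<forall>\<^sub>F N in sequentially. C \<le> ln (real N)"
  by (rule filterlim_at_top[THEN iffD1, rule_format]) real_asymp

lemma eventually_sqrt_ln_ge: "\<forall>\<^sub>F N in sequentially. C \<le> sqrt (ln (real N))"
  by (rule filterlim_at_top[THEN iffD1, rule_format]) real_asymp

lemma eventually_ln_over_le: "0 < d \<Longrightarrow> \<forall>\<^sub>F N in sequentially. C * ln (real N) / real N \<le> d"
proof -
  assume "0 < d"
  have "(\<lambda>N. C * ln (real N) / real N) \<longlonglongrightarrow> 0" by real_asymp
  from order_tendstoD(2)[OF this \<open>0 < d\<close>] show ?thesis by eventually_elim simp
qed

lemma eventually_variance_ge: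
  fixes a b M :: real
  assumes "0 < b"
  shows "\<forall>\<^sub>F N in sequentially. M \<le> (b * real N - a) * ln (real N) / real N"
proof -
  have "\<forall>\<^sub>F N in sequentially. 2 * \<bar>M\<bar> / b \<le> ln (real N) \<and> 2 * \<bar>a\<bar> / b \<le> real N \<and> 1 \<le> N"
    by (intro eventually_conj eventually_ln_ge eventually_ge_at_top
        filterlim_at_top[THEN iffD1, rule_format, OF filterlim_real_sequentially])
  then show ?thesis
  proof eventually_elim
    case (elim N)
    have "2 * a \<le> b * real N"
      using elim assms abs_ge_self[of a] by (simp add: field_simps)
    then have "b / 2 \<le> (b * real N - a) / real N"
      using elim by (simp add: field_simps)
    then have le: "b / 2 * ln (real N) \<le> (b * real N - a) / real N * ln (real N)"
      using elim by (intro mult_right_mono) auto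
    have "\<bar>M\<bar> \<le> b / 2 * ln (real N)"
      using elim assms by (simp add: field_simps)
    then have "M \<le> b / 2 * ln (real N)"
      using abs_ge_self[of M] by linarith
    also note le
    finally show ?case by simp
  qed
qed

text \<open>
  A red vertex is pulled towards blue by \<open>u ln N\<close>, up to a nonnegative term of order \<open>ln N / N\<close>, where \<open>u\<close>
  is the weighted advantage divided by \<open>N\<close>. The variance is \<open>(\<sigma>\<^sup>2 - (a - b)/(a + b) u) ln N\<close> up to the
  same order. For positive \<open>u\<close> the variance is thus
  smaller than \<open>\<sigma>\<^sup>2 ln N\<close>, which helps when \<open>x \<ge> 0\<close>; for negative \<open>u\<close> it is essentially at least
  \<open>\<sigma>\<^sup>2 ln N\<close>, which helps when \<open>x < 0\<close>. In the remaining case the signs alone decide.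
\<close>

lemma red_drift:
  fixes a b K x :: real
  defines "\<sigma> \<equiv> sqrt (2 * a * b / (a + b))"
  assumes "0 < b" "b < a" "x < K / \<sigma>"
  shows "\<forall>\<^sub>F N in sequentially. \<forall>B R. 0 \<le> B \<longrightarrow> 0 \<le> R \<longrightarrow> B + R = real N \<longrightarrow>
    K * (real N / sqrt (ln (real N))) \<le> b * B - a * R \<longrightarrow>
    x * sqrt ((b * B + a * (R - 1)) * ln (real N) / real N) \<le> (b * B - a * (R - 1)) * ln (real N) / real N"
proof -
  have \<sigma>: "0 < \<sigma>" "\<sigma>\<^sup>2 = 2 * a * b / (a + b)"
    using assms by (auto simp: \<sigma>_def)
  then have xK: "x * \<sigma> < K"
    using assms(4) by (simp add: field_simps)
  have "(\<lambda>N. x * sqrt (\<sigma>\<^sup>2 - a / real N)) \<longlonglongrightarrow> x * sqrt (\<sigma>\<^sup>2 - 0)"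
    by (intro tendsto_intros real_tendsto_divide_at_top[OF tendsto_const filterlim_real_sequentially])
  then have "\<forall>\<^sub>F N in sequentially. x * sqrt (\<sigma>\<^sup>2 - a / real N) < K"
    using xK \<sigma>(1) by (intro order_tendstoD(2)) auto
  moreover have "\<forall>\<^sub>F N in sequentially. 1 \<le> ln (real N)"
    by (rule eventually_ln_ge)
  moreover have "\<forall>\<^sub>F N in sequentially. 0 \<le> (b * real N - a) * ln (real N) / real N"
    using assms by (intro eventually_variance_ge)
  ultimately show ?thesis
  proof eventually_elim
    case (elim N)
    define L where "L = ln (real N)"
    have L: "1 \<le> L" and N: "0 < real N"
      using elim by (cases "N = 0"; simp add: L_def)+
    have sqrtL: "sqrt L * sqrt L = L" "0 < sqrt L" using L by auto
    show ?case
    proof (intro allI impI, fold L_def)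
      fix B R :: real
      assume BR: "0 \<le> B" "0 \<le> R" "B + R = real N" and adv: "K * (real N / sqrt L) \<le> b * B - a * R"
      define u where "u = (b * B - a * R) / real N"
      define V where "V = (b * B + a * (R - 1)) * L / real N"
      have u: "K / sqrt L \<le> u"
        using adv N by (simp add: u_def field_simps)
      have "K * sqrt L = K / sqrt L * L"
        using sqrtL by (simp add: field_simps)
      also have "\<dots> \<le> u * L"
        using u L by (intro mult_right_mono) auto
      finally have uL: "K * sqrt L \<le> u * L" .
      have rhs: "(b * B - a * (R - 1)) * L / real N = u * L + a * L / real N"
        by (simp add: u_def algebra_simps add_divide_distrib diff_divide_distrib)
      have R_eq: "R = real N - B" using BR by simp
      have V: "V = (\<sigma>\<^sup>2 - (a - b) / (a + b) * u) * L - a * L / real N"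
      proof -
        have "b * B + a * (real N - B) = (2 * a * b / (a + b) - (a - b) / (a + b) * ((b * B - a * (real N - B)) / real N)) * real N"
          using N assms by (simp add: divide_simps) (simp add: algebra_simps)
        then have "b * B + a * R = (\<sigma>\<^sup>2 - (a - b) / (a + b) * u) * real N"
          by (simp add: \<sigma> u_def R_eq)
        moreover have "b * B + a * (R - 1) = b * B + a * R - a"
          by (simp add: algebra_simps)
        ultimately have "V = ((\<sigma>\<^sup>2 - (a - b) / (a + b) * u) * real N - a) * L / real N"
          by (simp only: V_def)
        moreover have "(c * real N - a) * L / real N = c * L - a * L / real N" for c
          using N by (simp add: field_simps)
        ultimately show ?thesis by (simp only:)
      qed
      have "0 \<le> (b * real N - a) * L / real N"
        using elim by (simp add: L_def)
      also have "\<dots> \<le> V"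
        unfolding V_def using assms BR L mult_right_mono[of b a R]
        by (intro divide_right_mono mult_right_mono) (auto simp: algebra_simps R_eq)
      finally have "0 \<le> V" .
      have "x * sqrt V \<le> u * L + a * L / real N"
      proof (cases "0 \<le> x")
        case True
        then have "0 < K" using xK \<sigma> by (smt (verit) mult_nonneg_nonneg)
        then have "0 < u" using u sqrtL by (smt (verit) divide_pos_pos)
        then have "V \<le> \<sigma>\<^sup>2 * L"
          unfolding V using assms L N by (simp add: algebra_simps add_nonneg_nonneg)
        then have "sqrt V \<le> \<sigma> * sqrt L"
          using \<sigma> by (metis real_sqrt_abs real_sqrt_le_mono real_sqrt_mult abs_of_pos)
        then have "x * sqrt V \<le> (x * \<sigma>) * sqrt L"
          using True by (simp add: mult_left_mono mult.assoc)
        also have "\<dots> \<le> K * sqrt L" using xK sqrtL by simp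
        also have "\<dots> \<le> u * L + a * L / real N"
          using uL assms L N by (simp add: add_increasing2)
        finally show ?thesis .
      next
        case False
        show ?thesis
        proof (cases "0 \<le> u")
          case True
          then have "x * sqrt V \<le> 0" "0 \<le> u * L + a * L / real N"
            using False \<open>0 \<le> V\<close> assms L N by (auto simp: mult_nonpos_nonneg)
          then show ?thesis by linarith
        next
          case u_neg: False
          then have "(a - b) / (a + b) * u \<le> 0"
            using assms by (intro mult_nonneg_nonpos) auto
          then have "(a - b) / (a + b) * u * L \<le> 0"
            using L by (intro mult_nonpos_nonneg[of _ L]) auto
          moreover have "(\<sigma>\<^sup>2 - a / real N) * L \<le> (\<sigma>\<^sup>2 - c) * L - a * L / real N" if "c * L \<le> 0" for c
            using that by (simp add: algebra_simps)
          ultimately have "(\<sigma>\<^sup>2 - a / real N) * L \<le> V"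
            unfolding V by blast
          then have "sqrt (\<sigma>\<^sup>2 - a / real N) * sqrt L \<le> sqrt V"
            by (metis real_sqrt_le_mono real_sqrt_mult)
          then have "x * sqrt V \<le> x * sqrt (\<sigma>\<^sup>2 - a / real N) * sqrt L"
            using False by (simp add: mult_left_mono_neg mult.assoc)
          also have "\<dots> \<le> K * sqrt L"
            using elim(1) sqrtL by (intro mult_right_mono) auto
          also have "\<dots> \<le> u * L + a * L / real N"
            using uL assms L N by (simp add: add_increasing2)
          finally show ?thesis .
        qed
      qed
      then show "x * sqrt ((b * B + a * (R - 1)) * L / real N) \<le> (b * B - a * (R - 1)) * L / real N"
        by (simp only: rhs V_def)
    qed
  qed
qed

text \<open>
  A blue vertex is pulled towards blue by \<open>(a - b + u) ln N\<close> up to \<open>O(ln N / N)\<close>, with \<open>u\<close> the weighted advantage divided by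
  \<open>N\<close>. The term \<open>(a - b) ln N\<close> outgrows every multiple of the standard deviation, which is of order
  \<open>sqrt (ln N)\<close>.
\<close>

lemma blue_drift:
  fixes a b K x :: real
  assumes "0 < b" "b < a"
  shows "\<forall>\<^sub>F N in sequentially. \<forall>B R. 0 \<le> B \<longrightarrow> 0 \<le> R \<longrightarrow> B + R = real N \<longrightarrow>
    K * (real N / sqrt (ln (real N))) \<le> b * B - a * R \<longrightarrow>
    x * sqrt ((a * (B - 1) + b * R) * ln (real N) / real N) \<le> (a * (B - 1) - b * R) * ln (real N) / real N"
proof -
  have "\<forall>\<^sub>F N in sequentially. 1 \<le> ln (real N)"
    by (rule eventually_ln_ge)
  moreover have "\<forall>\<^sub>F N in sequentially. (\<bar>x\<bar> * sqrt a + \<bar>K\<bar> + a) / (a - b) \<le> sqrt (ln (real N))"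
    by (rule eventually_sqrt_ln_ge)
  moreover have "\<forall>\<^sub>F N in sequentially. 0 \<le> (b * real N - a) * ln (real N) / real N"
    using assms by (intro eventually_variance_ge)
  ultimately show ?thesis
  proof eventually_elim
    case (elim N)
    define L where "L = ln (real N)"
    have L: "1 \<le> L" and N: "0 < real N"
      using elim by (cases "N = 0"; simp add: L_def)+
    have sqrtL: "sqrt L * sqrt L = L" "1 \<le> sqrt L" using L by auto
    show ?case
    proof (intro allI impI, fold L_def)
      fix B R :: real
      assume BR: "0 \<le> B" "0 \<le> R" "B + R = real N" and adv: "K * (real N / sqrt L) \<le> b * B - a * R"
      define V where "V = (a * (B - 1) + b * R) * L / real N"
      have "K * (real N / sqrt L) * L / real N \<le> (b * B - a * R) * L / real N"
        using adv L N by (intro divide_right_mono mult_right_mono) auto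
      moreover have "K * (real N / sqrt L) * L / real N = K * (L / sqrt L)"
        using N by simp
      moreover have "L / sqrt L = sqrt L"
        using L by (intro real_div_sqrt) auto
      ultimately have uL: "K * sqrt L \<le> (b * B - a * R) * L / real N"
        by (simp only:)
      have B_eq: "B = real N - R" using BR by simp
      have "a * (B - 1) + b * R \<le> a * real N"
        using assms BR mult_right_mono[of b a R] by (simp add: B_eq algebra_simps)
      then have "V \<le> a * real N * L / real N"
        unfolding V_def using L N by (intro divide_right_mono mult_right_mono) auto
      then have "V \<le> a * L" using N by simp
      then have "sqrt V \<le> sqrt a * sqrt L"
        by (metis real_sqrt_le_mono real_sqrt_mult)
      have "0 \<le> (b * real N - a) * L / real N"
        using elim by (simp add: L_def)
      also have "\<dots> \<le> V"
        unfolding V_def using assms BR L N mult_right_mono[of b a "real N - R"]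
        by (intro divide_right_mono mult_right_mono) (auto simp: B_eq algebra_simps)
      finally have "0 \<le> V" .
      have "L / real N \<le> 1" using N ln_le_minus_one[OF N] by (simp add: L_def)
      then have LN: "a * (L / real N) \<le> a * sqrt L"
        using assms order_trans[OF _ sqrtL(2)] by (intro mult_left_mono) auto
      have "x * sqrt V \<le> \<bar>x\<bar> * sqrt V"
        using \<open>0 \<le> V\<close> by (intro mult_right_mono) auto
      also have "\<dots> \<le> \<bar>x\<bar> * (sqrt a * sqrt L)"
        using \<open>sqrt V \<le> _\<close> by (intro mult_left_mono) auto
      finally have 1: "x * sqrt V \<le> \<bar>x\<bar> * sqrt a * sqrt L" by simp
      have "\<bar>x\<bar> * sqrt a + \<bar>K\<bar> + a \<le> (a - b) * sqrt L"
        using elim(2) assms by (simp add: L_def field_simps)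
      then have "(\<bar>x\<bar> * sqrt a + \<bar>K\<bar> + a) * sqrt L \<le> (a - b) * sqrt L * sqrt L"
        using sqrtL by (intro mult_right_mono) auto
      then have 2: "\<bar>x\<bar> * sqrt a * sqrt L + \<bar>K\<bar> * sqrt L + a * sqrt L \<le> (a - b) * L"
        using sqrtL by (simp add: algebra_simps)
      have 3: "- (\<bar>K\<bar> * sqrt L) \<le> K * sqrt L"
        using sqrtL mult_right_mono[of "- \<bar>K\<bar>" K "sqrt L"] by simp
      have rhs: "(a * (B - 1) - b * R) * L / real N =
          (a - b) * L + (b * B - a * R) * L / real N - a * (L / real N)"
        using N by (simp add: field_simps B_eq)
      show "x * sqrt ((a * (B - 1) + b * R) * L / real N) \<le> (a * (B - 1) - b * R) * L / real N"
        using 1 2 3 uL LN unfolding rhs V_def[symmetric] by linarith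
    qed
  qed
qed

section \<open>The proportion of red vertices after one update\<close>

text \<open>
  The first-moment bound combines a probability of about \<open>1 - \<Phi>(K/\<sigma>)\<close> for the red vertices, at most about
  \<open>b N / (a + b)\<close> in number, with an arbitrarily small one for the blue vertices. Concentration costs
  \<open>O(ln N / N)\<close>, which is below any power of \<open>N\<close> with exponent above \<open>-1\<close>; the exponent \<open>-1/2\<close> is a
  convenient choice, and the factor \<open>1/2\<close> allows two such errors to be added.
\<close>

lemma prob_many_red_after_update:
  fixes a b K q :: real
  assumes ab: "1 < b" "b < a"
    and q: "b / (a + b) * (1 - std_normal_cdf (K / sqrt (2 * a * b / (a + b)))) < q"
  shows "\<forall>\<^sub>F N in sequentially. \<forall>y\<in>configs N.
    K * (real N / sqrt (ln (real N))) \<le> weighted_advantage a b N y \<longrightarrow>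
    measure_pmf.prob (random_graph a b N y) {G. q * real N < card (red N (majority_update N G y))}
      \<le> real N powr (- 1 / 2) / 2"
proof -
  have b_pos: "0 < b" using ab by simp
  define \<sigma> where "\<sigma> = sqrt (2 * a * b / (a + b))"
  have "1 - std_normal_cdf (K / \<sigma>) < q / (b / (a + b))"
    using q ab by (subst pos_less_divide_eq) (auto simp: \<sigma>_def mult.commute)
  from dense[OF this] obtain q1 where q1: "1 - std_normal_cdf (K / \<sigma>) < q1" "q1 < q / (b / (a + b))"
    by blast
  have q1_q: "b / (a + b) * q1 < q"
    using q1(2) ab by (subst (asm) pos_less_divide_eq) (auto simp: mult.commute)
  have q1_pos: "0 < q1"
    using q1(1) std_normal_cdf_bounds(2)[of "K / \<sigma>"] by linarith
  \<comment> \<open>One third of the slack each for blue vertices turning red, for an excess of red vertices at the start, and for the fluctuation.\<close>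
  define q2 where "q2 = (q - b / (a + b) * q1) / 3"
  have "q = 3 * ((q - x) / 3) + x" for x by (simp add: diff_divide_distrib)
  then have q_eq: "q = 3 * q2 + b / (a + b) * q1" unfolding q2_def .
  have q2: "0 < q2" using q1_q by (simp add: q2_def)
  \<comment> \<open>Lowering \<open>K / \<sigma>\<close> slightly to \<open>x1\<close> makes room for the lower-order terms of drift and variance.\<close>
  obtain x1 where x1: "x1 < K / \<sigma>" "1 - std_normal_cdf x1 < q1"
  proof -
    have "(std_normal_cdf \<longlongrightarrow> std_normal_cdf (K / \<sigma>)) (at_left (K / \<sigma>))"
      using isCont_std_normal_cdf[of "K / \<sigma>"] by (auto simp: isCont_def intro: tendsto_within_subset)
    then have "\<forall>\<^sub>F x in at_left (K / \<sigma>). 1 - q1 < std_normal_cdf x"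
      using q1 by (intro order_tendstoD(1)) auto
    moreover have "\<forall>\<^sub>F x in at_left (K / \<sigma>). x < K / \<sigma>"
      by (auto simp: eventually_at_filter)
    ultimately have "\<forall>\<^sub>F x in at_left (K / \<sigma>). x < K / \<sigma> \<and> 1 - std_normal_cdf x < q1"
      by eventually_elim auto
    then show thesis
      using that eventually_happens'[OF trivial_limit_at_left_real] by blast
  qed
  obtain x2 where x2: "1 - std_normal_cdf x2 < q2"
  proof -
    have "\<forall>\<^sub>F x in at_top. 1 - q2 < std_normal_cdf x"
      using std_normal_cdf_tendsto(1) q2 by (intro order_tendstoD(1)) auto
    then have "\<exists>x. 1 - q2 < std_normal_cdf x"
      by (rule eventually_happens'[OF trivial_limit_at_top_linorder])
    then show thesis
      using that by (auto simp: algebra_simps)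
  qed
  from bernoulli_sum_tail_le[OF x1(2), where 'a = "nat set"] obtain M1 where "0 < M1"
    and M1: "\<And>E p w. finite E \<Longrightarrow>
      (\<forall>e\<in>E. 0 \<le> p e \<and> p e \<le> 1 \<and> p e \<le> 1 / M1 \<and> \<bar>w e\<bar> \<le> 1) \<Longrightarrow>
      M1 \<le> (\<Sum>e\<in>E. p e * (w e)\<^sup>2) \<Longrightarrow>
      x1 * sqrt (\<Sum>e\<in>E. p e * (w e)\<^sup>2) \<le> - (\<Sum>e\<in>E. p e * w e) \<Longrightarrow>
      measure_pmf.prob (bernoulli_product E p) {f :: nat set \<Rightarrow> bool. 0 \<le> bernoulli_sum E w f} \<le> q1"
    by blast
  from bernoulli_sum_tail_le[OF x2, where 'a = "nat set"] obtain M2 where "0 < M2"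
    and M2: "\<And>E p w. finite E \<Longrightarrow>
      (\<forall>e\<in>E. 0 \<le> p e \<and> p e \<le> 1 \<and> p e \<le> 1 / M2 \<and> \<bar>w e\<bar> \<le> 1) \<Longrightarrow>
      M2 \<le> (\<Sum>e\<in>E. p e * (w e)\<^sup>2) \<Longrightarrow>
      x2 * sqrt (\<Sum>e\<in>E. p e * (w e)\<^sup>2) \<le> - (\<Sum>e\<in>E. p e * w e) \<Longrightarrow>
      measure_pmf.prob (bernoulli_product E p) {f :: nat set \<Rightarrow> bool. 0 \<le> bernoulli_sum E w f} \<le> q2"
    by blast
  have "\<forall>\<^sub>F N in sequentially. 4 * a / q2\<^sup>2 * (ln (real N) / real N) \<le> real N powr (- 1 / 2) / 2"
  proof -
    have "(\<lambda>N. 8 * a / q2\<^sup>2 * (ln (real N) / real N) * real N powr (1 / 2)) \<longlonglongrightarrow> 0"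
      by real_asymp
    then have "\<forall>\<^sub>F N in sequentially. 8 * a / q2\<^sup>2 * (ln (real N) / real N) * real N powr (1 / 2) < 1"
      by (rule order_tendstoD) simp
    then show ?thesis
      using eventually_gt_at_top[of 0]
      by eventually_elim (simp add: powr_minus field_simps)
  qed
  moreover have "\<forall>\<^sub>F N in sequentially. a * ln (real N) / real N \<le> min 1 (min (1 / M1) (1 / M2))"
    using \<open>0 < M1\<close> \<open>0 < M2\<close> by (intro eventually_ln_over_le) auto
  moreover have "\<forall>\<^sub>F N in sequentially. max M1 M2 \<le> (b * real N - a) * ln (real N) / real N"
    using ab by (intro eventually_variance_ge) auto
  moreover have "\<forall>\<^sub>F N in sequentially. \<bar>K\<bar> * q1 / ((a + b) * q2) \<le> sqrt (ln (real N))"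
    by (rule eventually_sqrt_ln_ge)
  moreover have "\<forall>\<^sub>F N in sequentially. 1 \<le> ln (real N)"
    by (rule eventually_ln_ge)
  moreover note red_drift[of b a x1 K, folded \<sigma>_def, OF b_pos ab(2) x1(1)] blue_drift[OF b_pos ab(2), of K x2]
  ultimately show ?thesis
  proof (eventually_elim, intro ballI impI)
    fix N y
    assume small: "4 * a / q2\<^sup>2 * (ln (real N) / real N) \<le> real N powr (- 1 / 2) / 2"
      and p_le: "a * ln (real N) / real N \<le> min 1 (min (1 / M1) (1 / M2))"
      and var_ge: "max M1 M2 \<le> (b * real N - a) * ln (real N) / real N"
      and sqrt_ln: "\<bar>K\<bar> * q1 / ((a + b) * q2) \<le> sqrt (ln (real N))"
      and ln_ge: "1 \<le> ln (real N)"
      and rdrift: "\<forall>B R. 0 \<le> B \<longrightarrow> 0 \<le> R \<longrightarrow> B + R = real N \<longrightarrow>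
        K * (real N / sqrt (ln (real N))) \<le> b * B - a * R \<longrightarrow>
        x1 * sqrt ((b * B + a * (R - 1)) * ln (real N) / real N) \<le> (b * B - a * (R - 1)) * ln (real N) / real N"
      and bdrift: "\<forall>B R. 0 \<le> B \<longrightarrow> 0 \<le> R \<longrightarrow> B + R = real N \<longrightarrow>
        K * (real N / sqrt (ln (real N))) \<le> b * B - a * R \<longrightarrow>
        x2 * sqrt ((a * (B - 1) + b * R) * ln (real N) / real N) \<le> (a * (B - 1) - b * R) * ln (real N) / real N"
      and y: "y \<in> configs N"
      and adv: "K * (real N / sqrt (ln (real N))) \<le> weighted_advantage a b N y"
    define B where "B = real (card (blue N y))"
    define R where "R = real (card (red N y))"
    have BR: "0 \<le> B" "0 \<le> R" "B + R = real N"
      using card_blue_add_card_red[OF y] by (auto simp: B_def R_def)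
    have adv': "K * (real N / sqrt (ln (real N))) \<le> b * B - a * R"
      using adv by (simp add: weighted_advantage_def B_def R_def)
    have N: "0 < real N" using ln_ge by (cases "N = 0") auto
    let ?E = "vertex_pairs N" and ?p = "edge_prob a b N y"
    let ?P = "measure_pmf.prob (bernoulli_product ?E ?p)"
    have p: "0 \<le> ?p e" "?p e \<le> a * ln N / N" for e
      using edge_prob_bounds[of b a N y e] ab N by auto
    have w: "\<forall>e\<in>?E. 0 \<le> ?p e \<and> ?p e \<le> 1 \<and> ?p e \<le> 1 / M1 \<and> \<bar>pull y v e\<bar> \<le> 1"
      "\<forall>e\<in>?E. 0 \<le> ?p e \<and> ?p e \<le> 1 \<and> ?p e \<le> 1 / M2 \<and> \<bar>pull y v e\<bar> \<le> 1" for v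
      using p p_le order_trans[OF p(2)] by (auto intro!: abs_pull_le[OF y])
    have "?P {f. 0 \<le> bernoulli_sum ?E (pull y v) f} \<le> (if v \<in> red N y then q1 else q2)"
      if v: "v \<in> vertices N" for v
    proof (cases "v \<in> red N y")
      case True
      have "(\<Sum>e\<in>?E. ?p e * pull y v e) = (a * (R - 1) - b * B) * ln (real N) / real N"
        using sum_edge_prob_pull[OF y v, of "\<lambda>t. t" a b] True by (simp add: B_def R_def)
      also have "\<dots> = - ((b * B - a * (R - 1)) * ln (real N) / real N)"
        by (subst minus_divide_left, subst minus_mult_left) simp
      finally have drift: "(\<Sum>e\<in>?E. ?p e * pull y v e) = - ((b * B - a * (R - 1)) * ln (real N) / real N)" .
      have var: "(\<Sum>e\<in>?E. ?p e * (pull y v e)\<^sup>2) = (b * B + a * (R - 1)) * ln (real N) / real N"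
        using sum_edge_prob_pull[OF y v, of "\<lambda>t. t\<^sup>2" a b] True by (simp add: B_def R_def)
      have "b * real N - a \<le> b * B + a * (R - 1)"
        using ab BR(2) mult_right_mono[of b a R] by (simp add: BR(3)[symmetric] algebra_simps)
      then have "(b * real N - a) * ln (real N) / real N \<le> (b * B + a * (R - 1)) * ln (real N) / real N"
        using ln_ge by (intro divide_right_mono mult_right_mono) auto
      then have "?P {f. 0 \<le> bernoulli_sum ?E (pull y v) f} \<le> q1"
        using rdrift[rule_format, OF BR adv'] var_ge
        by (intro M1 w finite_vertex_pairs) (simp_all add: drift var)
      then show ?thesis using True by simp
    next
      case False
      have "(\<Sum>e\<in>?E. ?p e * pull y v e) = (b * R - a * (B - 1)) * ln (real N) / real N"
        using sum_edge_prob_pull[OF y v, of "\<lambda>t. t" a b] False by (simp add: B_def R_def)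
      also have "\<dots> = - ((a * (B - 1) - b * R) * ln (real N) / real N)"
        by (subst minus_divide_left, subst minus_mult_left) simp
      finally have drift: "(\<Sum>e\<in>?E. ?p e * pull y v e) = - ((a * (B - 1) - b * R) * ln (real N) / real N)" .
      have var: "(\<Sum>e\<in>?E. ?p e * (pull y v e)\<^sup>2) = (a * (B - 1) + b * R) * ln (real N) / real N"
        using sum_edge_prob_pull[OF y v, of "\<lambda>t. t\<^sup>2" a b] False by (simp add: B_def R_def)
      have "b * real N - a \<le> a * (B - 1) + b * R"
        using ab BR(1) mult_right_mono[of b a B] by (simp add: BR(3)[symmetric] algebra_simps)
      then have "(b * real N - a) * ln (real N) / real N \<le> (a * (B - 1) + b * R) * ln (real N) / real N"
        using ln_ge by (intro divide_right_mono mult_right_mono) auto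
      then have "?P {f. 0 \<le> bernoulli_sum ?E (pull y v) f} \<le> q2"
        using bdrift[rule_format, OF BR adv'] var_ge
        by (intro M2 w finite_vertex_pairs) (simp_all add: drift var)
      then show ?thesis using False by simp
    qed
    then have "measure_pmf.expectation (bernoulli_product ?E ?p) (red_count N y) \<le>
        (\<Sum>v\<in>vertices N. if v \<in> red N y then q1 else q2)"
      by (intro expectation_red_count_le y)
    also have "\<dots> = (\<Sum>v\<in>blue N y. if v \<in> red N y then q1 else q2) + (\<Sum>v\<in>red N y. if v \<in> red N y then q1 else q2)"
      unfolding vertices_eq_blue_Un_red[OF y]
      by (intro sum.union_disjoint) (auto simp: blue_def red_def)
    also have "(\<Sum>v\<in>blue N y. if v \<in> red N y then q1 else q2) = (\<Sum>v\<in>blue N y. q2)"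
      by (intro sum.cong) (auto simp: blue_def red_def)
    also have "(\<Sum>v\<in>blue N y. q2) + (\<Sum>v\<in>red N y. if v \<in> red N y then q1 else q2) = B * q2 + R * q1"
      by (simp add: B_def R_def)
    also have "B * q2 \<le> q2 * real N"
      using BR q2 by (simp add: mult.commute mult_left_mono)
    \<comment> \<open>The initial red proportion exceeds \<open>b / (a + b)\<close> by at most \<open>\<bar>K\<bar> / ((a + b) sqrt (ln N))\<close>.\<close>
    also have "R * q1 \<le> b / (a + b) * q1 * real N + q2 * real N"
    proof -
      have "- (\<bar>K\<bar> * (real N / sqrt (ln (real N)))) \<le> K * (real N / sqrt (ln (real N)))"
        using mult_right_mono[of "- \<bar>K\<bar>" K "real N / sqrt (ln (real N))"] ln_ge by simp
      moreover have "b * B - a * R = b * real N - (a + b) * R"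
        using BR(3)[symmetric] by (simp only:) (simp add: algebra_simps)
      ultimately have "(a + b) * R \<le> b * real N + \<bar>K\<bar> * (real N / sqrt (ln (real N)))"
        using adv' by linarith
      then have "R \<le> (b * real N + \<bar>K\<bar> * (real N / sqrt (ln (real N)))) / (a + b)"
        using ab by (simp add: field_simps)
      then have "R * q1 \<le> (b * real N + \<bar>K\<bar> * (real N / sqrt (ln (real N)))) / (a + b) * q1"
        using q1_pos by (intro mult_right_mono) auto
      also have "\<dots> = b / (a + b) * q1 * real N + (\<bar>K\<bar> * q1 / (a + b)) / sqrt (ln (real N)) * real N"
        by (simp add: add_divide_distrib algebra_simps)
      also have "\<dots> \<le> b / (a + b) * q1 * real N + q2 * real N"
      proof -
        have "\<bar>K\<bar> * q1 / (a + b) / q2 \<le> sqrt (ln (real N))"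
          using sqrt_ln by simp
        then have "\<bar>K\<bar> * q1 / (a + b) \<le> q2 * sqrt (ln (real N))"
          using q2 by (subst (asm) pos_divide_le_eq) (simp_all only: mult.commute)
        then have "(\<bar>K\<bar> * q1 / (a + b)) / sqrt (ln (real N)) \<le> q2"
          using ln_ge by (subst pos_divide_le_eq) auto
        then show ?thesis
          by (intro add_left_mono mult_right_mono) auto
      qed
      finally show ?thesis .
    qed
    finally have "measure_pmf.expectation (bernoulli_product ?E ?p) (red_count N y) \<le>
        q2 * real N + (b / (a + b) * q1 * real N + q2 * real N)" by simp
    moreover have "q * real N = 3 * (q2 * real N) + b / (a + b) * q1 * real N"
      by (subst q_eq) (simp only: distrib_right mult.assoc)
    ultimately have mean: "measure_pmf.expectation (bernoulli_product ?E ?p) (red_count N y) + q2 * real N \<le> q * real N"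
      by linarith
    have "measure_pmf.prob (random_graph a b N y) {G. q * real N < card (red N (majority_update N G y))} =
        ?P {f. q * real N < red_count N y f}"
      unfolding prob_random_graph red_count_def ..
    also have "\<dots> \<le> ?P {f. measure_pmf.expectation (bernoulli_product ?E ?p) (red_count N y) + q2 * real N \<le> red_count N y f}"
      using mean by (intro measure_pmf.finite_measure_mono) auto
    also have "\<dots> \<le> 2\<^sup>2 * (\<Sum>e\<in>?E. ?p e) / (q2 * real N)\<^sup>2"
      using w(1) q2 N by (intro bernoulli_product_concentration red_count_bounded_difference) auto
    also have "\<dots> \<le> 2\<^sup>2 * ((real N)\<^sup>2 * (a * ln (real N) / real N)) / (q2 * real N)\<^sup>2"
    proof (intro divide_right_mono mult_left_mono)
      have "(\<Sum>e\<in>?E. ?p e) \<le> real (card ?E) * (a * ln (real N) / real N)"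
        using p by (intro sum_bounded_above) auto
      also have "\<dots> \<le> (real N)\<^sup>2 * (a * ln (real N) / real N)"
        using card_vertex_pairs_le[of N] ab ln_ge
        by (intro mult_right_mono) (auto simp flip: of_nat_power)
      finally show "(\<Sum>e\<in>?E. ?p e) \<le> (real N)\<^sup>2 * (a * ln (real N) / real N)" .
    qed auto
    also have "\<dots> = 4 * a / q2\<^sup>2 * (ln (real N) / real N)"
      using N by (simp add: power2_eq_square field_simps)
    finally show "measure_pmf.prob (random_graph a b N y) {G. q * real N < card (red N (majority_update N G y))}
        \<le> real N powr (- 1 / 2) / 2"
      using small by linarith
  qed
qed

section \<open>Extinction of red below the critical proportion\<close>

text \<open>
  Both bounds come from \<open>b (a + b - 1) - a = (a + b) (b - 1) > 0\<close>. The upper one says that \<open>r\<^sub>*\<close> lies below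
  the red proportion at which the weighted advantage vanishes.
\<close>

lemma r_star_bounds:
  assumes "1 < b" "b < a"
  shows "0 < r_star a b" "r_star a b < b / (a + b)"
proof -
  have "b * (a + b - 1) - a = (a + b) * (b - 1)"
    by (simp add: algebra_simps)
  moreover have "0 < (a + b) * (b - 1)"
    using assms by (intro mult_pos_pos) auto
  ultimately have "a < b * (a + b - 1)" by linarith
  then have gap: "0 < sqrt (b * (a + b - 1)) - sqrt a" by simp
  then show "0 < r_star a b"
    using assms by (simp add: r_star_def)
  have "(sqrt (b * (a + b - 1)) - sqrt a)\<^sup>2 < (sqrt (b * (a + b - 1)))\<^sup>2"
    using gap assms by (intro power_strict_mono) auto
  also have "\<dots> = b * (a + b - 1)"
    using assms by simp
  also have "\<dots> < b * (a + b)"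
    using assms by simp
  finally have "(sqrt (b * (a + b - 1)) - sqrt a)\<^sup>2 / (a + b)\<^sup>2 < b * (a + b) / (a + b)\<^sup>2"
    using assms by (intro divide_strict_right_mono) auto
  then show "r_star a b < b / (a + b)"
    using assms by (simp add: r_star_def power_divide power2_eq_square)
qed

text \<open>
  The square root of \<open>r\<^sub>*\<close> is the positive root of \<open>(a + b) x\<^sup>2 + 2 sqrt a x = b - 1\<close>, which is the equation
  \<open>(1 + sqrt a x)\<^sup>2 = b (1 - x\<^sup>2)\<close>. Below the root the equation becomes the claimed inequality.
\<close>

lemma below_r_star:
  assumes "1 < b" "b < a" "0 < r" "r < r_star a b"
  shows "1 + sqrt (a * r) < sqrt (b * (1 - r))"
proof -
  define x where "x = sqrt r"
  have x: "0 < x" "x\<^sup>2 = r" using assms by (auto simp: x_def)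
  have "a \<le> b * (a + b - 1)"
  proof -
    have "b * (a + b - 1) - a = (a + b) * (b - 1)"
      by (simp add: algebra_simps)
    moreover have "0 \<le> (a + b) * (b - 1)" using assms by simp
    ultimately show ?thesis by linarith
  qed
  then have "0 \<le> (sqrt (b * (a + b - 1)) - sqrt a) / (a + b)"
    using assms by simp
  then have "x < (sqrt (b * (a + b - 1)) - sqrt a) / (a + b)"
    using assms(4) x by (auto intro: power2_less_imp_less[where x = x] simp: r_star_def)
  then have "(a + b) * x + sqrt a < sqrt (b * (a + b - 1))"
    using assms by (simp add: field_simps)
  then have "((a + b) * x + sqrt a)\<^sup>2 < (sqrt (b * (a + b - 1)))\<^sup>2"
    using assms x by (intro power_strict_mono) auto
  then have "((a + b) * x + sqrt a)\<^sup>2 < b * (a + b - 1)"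
    using assms by simp
  moreover have "((a + b) * x + sqrt a)\<^sup>2 = (a + b) * ((a + b) * x\<^sup>2 + 2 * (sqrt a * x)) + (sqrt a)\<^sup>2"
    by (simp add: power2_eq_square algebra_simps)
  moreover have "b * (a + b - 1) = (a + b) * (b - 1) + a"
    by (simp add: algebra_simps)
  ultimately have "(a + b) * ((a + b) * x\<^sup>2 + 2 * (sqrt a * x)) < (a + b) * (b - 1)"
    using assms by simp
  then have "(a + b) * x\<^sup>2 + 2 * (sqrt a * x) < b - 1"
    using assms by (simp add: mult_less_cancel_left)
  moreover have "(1 + sqrt a * x)\<^sup>2 = 1 + 2 * (sqrt a * x) + a * x\<^sup>2"
    using assms by (simp add: power2_eq_square algebra_simps)
  ultimately have "(1 + sqrt a * x)\<^sup>2 < b * (1 - r)"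
    using x by (simp add: algebra_simps)
  then have "1 + sqrt a * x < sqrt (b * (1 - r))"
    by (rule real_less_rsqrt)
  then show ?thesis by (simp add: x_def real_sqrt_mult)
qed

text \<open>
  A Chernoff bound for each vertex and a union bound. The exponent is monotone in the number of red
  vertices, so the value of \<open>z\<close> that is optimal for exactly \<open>r N\<close> red vertices serves for all smaller
  numbers. The bound for red vertices also covers blue ones, because \<open>a > b\<close> makes
  edges to vertices of the own colour more likely.
\<close>

lemma prob_some_red_after_update:
  fixes a b r :: real
  assumes ab: "1 < b" "b < a" and r: "0 < r" "r < r_star a b"
  shows "\<exists>\<xi>>0. \<forall>\<^sub>F N in sequentially. \<forall>y\<in>configs N. card (red N y) \<le> r * real N \<longrightarrow>
    measure_pmf.prob (random_graph a b N y) {G. red N (majority_update N G y) \<noteq> {}} \<le> real N powr (- \<xi>)"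
proof -
  define s where "s = sqrt (b * (1 - r))"
  define d where "d = sqrt (a * r)"
  \<comment> \<open>\<open>z\<close> is the exponential of the optimal Chernoff parameter: it minimises \<open>b (1 - r) (1 / z - 1) + a r (z - 1)\<close>.\<close>
  define z where "z = s / d"
  define c where "c = (s - d)\<^sup>2"
  have d: "0 < d" using ab r by (simp add: d_def)
  have sd: "1 + d < s"
    using below_r_star[OF ab r] by (simp add: s_def d_def)
  have "0 < b * (1 - r)"
    using sd d unfolding s_def by (metis add_pos_pos less_trans real_sqrt_gt_0_iff zero_less_one)
  then have r1: "r < 1" using ab by (simp add: zero_less_mult_iff)
  have sq: "s\<^sup>2 = b * (1 - r)" "d\<^sup>2 = a * r"
    using ab r r1 by (auto simp: s_def d_def)
  have z: "1 < z" using sd d by (simp add: z_def)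
  have "1 < (s - d)\<^sup>2" using sd by (intro one_less_power) auto
  then have c: "1 < c" by (simp add: c_def)
  have exponent: "b * (1 - r) * (1 / z - 1) + a * r * (z - 1) = - c"
    unfolding sq[symmetric] c_def z_def using sd d
    by (simp add: power2_eq_square field_simps)
  \<comment> \<open>Half of the excess \<open>c - 1\<close> absorbs the constant factor in the union bound.\<close>
  define \<xi> where "\<xi> = (c - 1) / 2"
  have two_\<xi>: "2 * \<xi> = c - 1" by (simp add: \<xi>_def)
  have "0 < \<xi>" using c by (simp add: \<xi>_def)
  have "\<forall>\<^sub>F N in sequentially. a * ln (real N) / real N \<le> 1"
    by (rule eventually_ln_over_le) simp
  moreover have "\<forall>\<^sub>F N in sequentially. max 1 (1 / \<xi>) \<le> ln (real N)"
    by (rule eventually_ln_ge)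
  ultimately have "\<forall>\<^sub>F N in sequentially. \<forall>y\<in>configs N. card (red N y) \<le> r * real N \<longrightarrow>
    measure_pmf.prob (random_graph a b N y) {G. red N (majority_update N G y) \<noteq> {}} \<le> real N powr (- \<xi>)"
  proof (eventually_elim, intro ballI impI)
    fix N y
    assume p_le: "a * ln (real N) / real N \<le> 1" and ln_ge: "max 1 (1 / \<xi>) \<le> ln (real N)"
      and y: "y \<in> configs N" and red_le: "card (red N y) \<le> r * real N"
    define L where "L = ln (real N)"
    have L: "1 \<le> L" "1 \<le> \<xi> * L"
      using ln_ge \<open>0 < \<xi>\<close> by (auto simp: L_def field_simps)
    have N: "0 < real N" using L by (cases "N = 0") (auto simp: L_def)
    define B where "B = real (card (blue N y))"
    define R where "R = real (card (red N y))"
    have BR: "B + R = real N" "0 \<le> R" "R \<le> r * real N" "(1 - r) * real N \<le> B"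
      using card_blue_add_card_red[OF y] red_le by (auto simp: B_def R_def algebra_simps)
    let ?E = "vertex_pairs N" and ?p = "edge_prob a b N y"
    let ?P = "measure_pmf.prob (bernoulli_product ?E ?p)"
    have p: "0 \<le> ?p e" "?p e \<le> 1" for e
      using edge_prob_bounds[of b a N y e] ab N by (auto intro: order_trans[OF _ p_le])
    have main: "b * B * (1 / z - 1) + a * R * (z - 1) \<le> - c * real N"
    proof -
      have "b * B * (1 / z - 1) \<le> b * ((1 - r) * real N) * (1 / z - 1)"
        using BR ab z by (intro mult_right_mono_neg mult_left_mono) auto
      moreover have "a * R * (z - 1) \<le> a * (r * real N) * (z - 1)"
        using BR ab z by (intro mult_right_mono mult_left_mono) auto
      moreover have "b * ((1 - r) * real N) * (1 / z - 1) + a * (r * real N) * (z - 1) =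
          (b * (1 - r) * (1 / z - 1) + a * r * (z - 1)) * real N"
        by (simp only: algebra_simps)
      ultimately show ?thesis unfolding exponent by linarith
    qed
    have single: "?P {f. 0 \<le> bernoulli_sum ?E (pull y v) f} \<le> exp (1 - c * L)"
      if v: "v \<in> vertices N" for v
    proof -
      define h where "h t = exp (ln z * t) - 1" for t
      have h: "h 0 = 0" "h 1 = z - 1" "h (-1) = 1 / z - 1"
        using z by (auto simp: h_def exp_minus inverse_eq_divide)
      have "?P {f. 0 \<le> bernoulli_sum ?E (pull y v) f} \<le> exp (\<Sum>e\<in>?E. ?p e * h (pull y v e))"
        unfolding h_def using p z by (intro bernoulli_sum_chernoff) auto
      \<comment> \<open>The summand \<open>a\<close> pays for a blue vertex not being its own neighbour.\<close>
      also have "(\<Sum>e\<in>?E. ?p e * h (pull y v e)) \<le> (- c * real N + a) * L / real N"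
      proof (cases "v \<in> red N y")
        case True
        then have "(\<Sum>e\<in>?E. ?p e * h (pull y v e)) = (b * B * (1 / z - 1) + a * (R - 1) * (z - 1)) * L / real N"
          using sum_edge_prob_pull[OF y v, of h a b] h by (simp add: B_def R_def L_def)
        also have "b * B * (1 / z - 1) + a * (R - 1) * (z - 1) \<le> - c * real N + a"
        proof -
          have "a * (R - 1) * (z - 1) \<le> a * R * (z - 1)"
            using ab z by (intro mult_right_mono mult_left_mono) auto
          then show ?thesis using main ab by linarith
        qed
        finally show ?thesis using L N by (simp add: divide_right_mono mult_right_mono)
      next
        case False
        then have "(\<Sum>e\<in>?E. ?p e * h (pull y v e)) = (a * (B - 1) * (1 / z - 1) + b * R * (z - 1)) * L / real N"
          using sum_edge_prob_pull[OF y v, of h a b] h by (simp add: B_def R_def L_def)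
        also have "a * (B - 1) * (1 / z - 1) + b * R * (z - 1) \<le> - c * real N + a"
        proof -
          have "0 \<le> B" by (simp add: B_def)
          have "a * B * (1 / z - 1) \<le> b * B * (1 / z - 1)"
            using ab z \<open>0 \<le> B\<close> by (intro mult_right_mono_neg mult_right_mono) auto
          moreover have "b * R * (z - 1) \<le> a * R * (z - 1)"
            using ab z BR by (intro mult_right_mono) auto
          moreover have "a * (B - 1) * (1 / z - 1) = a * B * (1 / z - 1) + a * (1 - 1 / z)"
            by (simp add: algebra_simps)
          moreover have "a * (1 - 1 / z) \<le> a * 1"
            using ab z by (intro mult_left_mono) auto
          ultimately show ?thesis using main by linarith
        qed
        finally show ?thesis using L N by (simp add: divide_right_mono mult_right_mono)
      qed
      also have "(- c * real N + a) * L / real N = a * L / real N - c * L"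
        using N by (simp add: field_simps)
      also have "\<dots> \<le> 1 - c * L"
        using p_le by (simp add: L_def)
      finally show ?thesis by simp
    qed
    have "measure_pmf.prob (random_graph a b N y) {G. red N (majority_update N G y) \<noteq> {}} =
        ?P {f. red N (majority_update N {e \<in> ?E. f e} y) \<noteq> {}}"
      by (rule prob_random_graph)
    also have "\<dots> \<le> ?P (\<Union>v\<in>vertices N. {f. 0 \<le> bernoulli_sum ?E (pull y v) f})"
    proof (intro measure_pmf.finite_measure_mono subsetI)
      fix f assume "f \<in> {f. red N (majority_update N {e \<in> ?E. f e} y) \<noteq> {}}"
      then obtain v where v: "v \<in> red N (majority_update N {e \<in> ?E. f e} y)" by blast
      then have "v \<in> vertices N" unfolding red_def by blast
      with red_after_update_imp[OF y v] show "f \<in> (\<Union>v\<in>vertices N. {f. 0 \<le> bernoulli_sum ?E (pull y v) f})"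
        by blast
    qed simp
    also have "\<dots> \<le> (\<Sum>v\<in>vertices N. ?P {f. 0 \<le> bernoulli_sum ?E (pull y v) f})"
      by (intro measure_pmf.finite_measure_subadditive_finite) auto
    also have "\<dots> \<le> (\<Sum>v\<in>vertices N. exp (1 - c * L))"
      by (intro sum_mono single)
    also have "\<dots> = exp L * exp (1 - c * L)"
      using N by (simp add: L_def vertices_def)
    also have "\<dots> = exp (1 - 2 * \<xi> * L)"
      unfolding two_\<xi> by (simp add: algebra_simps flip: exp_add)
    also have "\<dots> \<le> exp (- \<xi> * L)"
      using L by (simp add: mult.commute)
    also have "\<dots> = real N powr (- \<xi>)"
      using N by (simp add: powr_def L_def)
    finally show "measure_pmf.prob (random_graph a b N y) {G. red N (majority_update N G y) \<noteq> {}} \<le> real N powr (- \<xi>)" .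
  qed
  with \<open>0 < \<xi>\<close> show ?thesis by blast
qed

section \<open>Chaining updates\<close>

lemma majority_update_in_configs: "y \<in> configs N \<Longrightarrow> majority_update N G y \<in> configs N"
  by (auto simp: configs_def majority_update_def Let_def Pi_iff)

lemma opinion_in_configs: "y \<in> configs N \<Longrightarrow> opinion N y Gs \<in> configs N"
  unfolding opinion_def by (induction Gs arbitrary: y) (auto intro: majority_update_in_configs)

lemma prob_bind_pmf_le:
  assumes "\<And>x. x \<in> A \<Longrightarrow> measure_pmf.prob (f x) S \<le> c" "0 \<le> c"
  shows "measure_pmf.prob (bind_pmf p f) S \<le> measure_pmf.prob p (- A) + c"
proof -
  have "emeasure (bind_pmf p f) S = (\<integral>\<^sup>+ x. emeasure (f x) S \<partial>p)"
    by simp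
  also have "\<dots> \<le> (\<integral>\<^sup>+ x. indicator (- A) x + ennreal c \<partial>p)"
  proof (rule nn_integral_mono)
    fix x
    show "emeasure (f x) S \<le> indicator (- A) x + ennreal c"
    proof (cases "x \<in> A")
      case True
      then show ?thesis
        using assms(1)[of x] by (simp add: measure_pmf.emeasure_eq_measure ennreal_leI)
    next
      case False
      have "emeasure (f x) S \<le> 1" by (rule measure_pmf.emeasure_le_1)
      then show ?thesis using False by (simp add: add_increasing2)
    qed
  qed
  also have "\<dots> = emeasure p (- A) + ennreal c"
    by (subst nn_integral_add) auto
  finally show ?thesis
    using assms(2) by (simp add: measure_pmf.emeasure_eq_measure flip: ennreal_plus)
qed

text \<open>
  The Markov property: given the history, the next graph depends on the current configuration only. An
  update that starts outside the exceptional event \<open>Q\<close> fails with probability at most \<open>c\<close>, hence failure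
  probabilities of successive updates add up.
\<close>

lemma prob_history_Suc_le:
  assumes y0: "y0 \<in> configs N"
    and step: "\<And>y. y \<in> configs N \<Longrightarrow> \<not> Q y \<Longrightarrow>
      measure_pmf.prob (random_graph a b N y) {G. P (majority_update N G y)} \<le> c" and "0 \<le> c"
  shows "measure_pmf.prob (history a b N y0 (Suc t)) {Gs. P (opinion N y0 Gs)} \<le>
    measure_pmf.prob (history a b N y0 t) {Gs. Q (opinion N y0 Gs)} + c"
proof -
  have "measure_pmf.prob (history a b N y0 (Suc t)) {Gs. P (opinion N y0 Gs)} \<le>
      measure_pmf.prob (history a b N y0 t) (- {Gs. \<not> Q (opinion N y0 Gs)}) + c"
    unfolding history.simps
  proof (rule prob_bind_pmf_le)
    fix Gs assume "Gs \<in> {Gs. \<not> Q (opinion N y0 Gs)}"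
    moreover have "(\<lambda>G. Gs @ [G]) -` {Gs. P (opinion N y0 Gs)} =
        {G. P (majority_update N G (opinion N y0 Gs))}"
      by (auto simp: opinion_def)
    ultimately show "measure_pmf.prob (map_pmf (\<lambda>G. Gs @ [G]) (random_graph a b N (opinion N y0 Gs)))
        {Gs. P (opinion N y0 Gs)} \<le> c"
      using step[OF opinion_in_configs[OF y0]] by simp
  qed fact
  also have "- {Gs. \<not> Q (opinion N y0 Gs)} = {Gs. Q (opinion N y0 Gs)}" by auto
  finally show ?thesis .
qed

lemma prob_blue_unanimity_eq:
  "prob_blue_unanimity a b N y0 T = 1 - measure_pmf.prob (history a b N y0 T) {Gs. red N (opinion N y0 Gs) \<noteq> {}}"
proof -
  have "{Gs. red N (opinion N y0 Gs) = {}} = UNIV - {Gs. red N (opinion N y0 Gs) \<noteq> {}}" by auto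
  then show ?thesis
    unfolding prob_blue_unanimity_def
    using measure_pmf.prob_compl[of "{Gs. red N (opinion N y0 Gs) \<noteq> {}}" "history a b N y0 T"] by simp
qed

lemma weighted_advantage_eq:
  assumes "y \<in> configs N"
  shows "weighted_advantage a b N y = b * real N - (a + b) * real (card (red N y))"
proof -
  have "real (card (blue N y)) = real N - real (card (red N y))"
    using card_blue_add_card_red[OF assms] by linarith
  then show ?thesis
    unfolding weighted_advantage_def by (simp only:) (simp add: algebra_simps)
qed

text \<open>
  Solving \<open>b/(a+b) (1 - \<Phi>(K/\<sigma>)) = r\<^sub>*\<close> for \<open>K\<close> gives \<open>K2\<close>. Strict monotonicity of \<open>\<Phi>\<close> keeps the
  inequality strict.
\<close>

lemma K2_threshold:
  assumes ab: "1 < b" "b < a" and K: "K2 a b < K"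
  shows "b / (a + b) * (1 - std_normal_cdf (K / sqrt (2 * a * b / (a + b)))) < r_star a b"
proof -
  define u where "u = 1 - (a + b) / b * r_star a b"
  have "(a + b) / b * r_star a b < (a + b) / b * (b / (a + b))"
    using r_star_bounds[OF ab] ab by (intro mult_strict_left_mono) auto
  moreover have "0 < (a + b) / b * r_star a b"
    using r_star_bounds[OF ab] ab by simp
  ultimately have u: "0 < u" "u < 1"
    using ab by (auto simp: u_def)
  have "0 < sqrt (2 * a * b / (a + b))" using ab by simp
  then have "inv std_normal_cdf u < K / sqrt (2 * a * b / (a + b))"
    using K by (simp add: K2_def u_def pos_less_divide_eq mult.commute)
  from std_normal_cdf_strict_mono[OF this]
  have "u < std_normal_cdf (K / sqrt (2 * a * b / (a + b)))"
    by (simp only: std_normal_cdf_inv[OF u])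
  then have "b / (a + b) * (1 - std_normal_cdf (K / sqrt (2 * a * b / (a + b)))) < b / (a + b) * (1 - u)"
    using ab by (intro mult_strict_left_mono) auto
  also have "b / (a + b) * (1 - u) = r_star a b"
    using ab by (simp add: u_def)
  finally show ?thesis .
qed

lemma blue_unanimity_one_update:
  assumes ab: "1 < b" "b < a" and r: "0 < r" "r < r_star a b"
  shows "\<exists>\<xi>>0. \<forall>\<^sub>F N in sequentially. \<forall>y\<in>configs N.
    (b - (a + b) * r) * real N \<le> weighted_advantage a b N y \<longrightarrow>
    prob_blue_unanimity a b N y 1 \<ge> 1 - real N powr (- \<xi>)"
proof -
  from prob_some_red_after_update[OF ab r] obtain \<xi> where "0 < \<xi>"
    and ev: "\<forall>\<^sub>F N in sequentially. \<forall>y\<in>configs N. card (red N y) \<le> r * real N \<longrightarrow>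
      measure_pmf.prob (random_graph a b N y) {G. red N (majority_update N G y) \<noteq> {}} \<le> real N powr (- \<xi>)"
    by blast
  have "\<forall>\<^sub>F N in sequentially. \<forall>y\<in>configs N.
    (b - (a + b) * r) * real N \<le> weighted_advantage a b N y \<longrightarrow>
    prob_blue_unanimity a b N y 1 \<ge> 1 - real N powr (- \<xi>)"
    using ev
  proof (eventually_elim, intro ballI impI)
    fix N y
    assume step: "\<forall>y\<in>configs N. card (red N y) \<le> r * real N \<longrightarrow>
        measure_pmf.prob (random_graph a b N y) {G. red N (majority_update N G y) \<noteq> {}} \<le> real N powr (- \<xi>)"
      and y: "y \<in> configs N" and adv: "(b - (a + b) * r) * real N \<le> weighted_advantage a b N y"
    have "(a + b) * real (card (red N y)) \<le> (a + b) * (r * real N)"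
      using adv by (simp add: weighted_advantage_eq[OF y] algebra_simps)
    then have few: "card (red N y) \<le> r * real N"
      using ab by simp
    have "measure_pmf.prob (history a b N y (Suc 0)) {Gs. red N (opinion N y Gs) \<noteq> {}} \<le>
        measure_pmf.prob (history a b N y 0) {Gs. r * real N < card (red N (opinion N y Gs))} + real N powr (- \<xi>)"
      using step by (intro prob_history_Suc_le y) auto
    moreover have "measure_pmf.prob (history a b N y 0) {Gs. r * real N < card (red N (opinion N y Gs))} = 0"
      using few by (simp add: opinion_def measure_return_pmf)
    ultimately show "prob_blue_unanimity a b N y 1 \<ge> 1 - real N powr (- \<xi>)"
      by (simp add: prob_blue_unanimity_eq del: history.simps)
  qed
  with \<open>0 < \<xi>\<close> show ?thesis by blast
qed

text \<open>
  The first update brings the red proportion below some \<open>r < r\<^sub>*\<close>, the second one removes red.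
\<close>

lemma blue_unanimity_two_updates:
  assumes ab: "1 < b" "b < a" and K: "K2 a b < K"
  shows "\<exists>\<xi>>0. \<forall>\<^sub>F N in sequentially. \<forall>y\<in>configs N.
    K * (real N / sqrt (ln (real N))) \<le> weighted_advantage a b N y \<longrightarrow>
    prob_blue_unanimity a b N y 2 \<ge> 1 - 2 * real N powr (- \<xi>)"
proof -
  let ?q = "b / (a + b) * (1 - std_normal_cdf (K / sqrt (2 * a * b / (a + b))))"
  from dense[OF K2_threshold[OF ab K]] obtain r where r: "?q < r" "r < r_star a b" by blast
  have "0 \<le> ?q"
    using ab std_normal_cdf_bounds(2) by (intro mult_nonneg_nonneg) auto
  with r have "0 < r" by linarith
  from prob_some_red_after_update[OF ab this r(2)] obtain \<xi> where "0 < \<xi>"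
    and last: "\<forall>\<^sub>F N in sequentially. \<forall>y\<in>configs N. card (red N y) \<le> r * real N \<longrightarrow>
      measure_pmf.prob (random_graph a b N y) {G. red N (majority_update N G y) \<noteq> {}} \<le> real N powr (- \<xi>)"
    by blast
  define \<eta> where "\<eta> = min \<xi> (1 / 2)"
  have "\<forall>\<^sub>F N in sequentially. \<forall>y\<in>configs N.
    K * (real N / sqrt (ln (real N))) \<le> weighted_advantage a b N y \<longrightarrow>
    prob_blue_unanimity a b N y 2 \<ge> 1 - 2 * real N powr (- \<eta>)"
    using last prob_many_red_after_update[OF ab r(1)] eventually_ge_at_top[of 1]
  proof (eventually_elim, intro ballI impI)
    fix N y
    assume last: "\<forall>y\<in>configs N. card (red N y) \<le> r * real N \<longrightarrow>
        measure_pmf.prob (random_graph a b N y) {G. red N (majority_update N G y) \<noteq> {}} \<le> real N powr (- \<xi>)"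
      and first: "\<forall>y\<in>configs N. K * (real N / sqrt (ln (real N))) \<le> weighted_advantage a b N y \<longrightarrow>
        measure_pmf.prob (random_graph a b N y) {G. r * real N < card (red N (majority_update N G y))}
          \<le> real N powr (- 1 / 2) / 2"
      and N: "1 \<le> N" and y: "y \<in> configs N"
      and adv: "K * (real N / sqrt (ln (real N))) \<le> weighted_advantage a b N y"
    let ?P = "\<lambda>t. measure_pmf.prob (history a b N y t)"
    have "?P (Suc (Suc 0)) {Gs. red N (opinion N y Gs) \<noteq> {}} \<le>
        ?P (Suc 0) {Gs. r * real N < card (red N (opinion N y Gs))} + real N powr (- \<xi>)"
      using last by (intro prob_history_Suc_le y) auto
    moreover have "?P (Suc 0) {Gs. r * real N < card (red N (opinion N y Gs))} \<le>
        ?P 0 {Gs. \<not> K * (real N / sqrt (ln (real N))) \<le> weighted_advantage a b N (opinion N y Gs)}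
          + real N powr (- 1 / 2) / 2"
      using first by (intro prob_history_Suc_le y) auto
    moreover have "?P 0 {Gs. \<not> K * (real N / sqrt (ln (real N))) \<le> weighted_advantage a b N (opinion N y Gs)} = 0"
      using adv by (simp add: opinion_def measure_return_pmf)
    moreover have "real N powr (- \<xi>) \<le> real N powr (- \<eta>)" "real N powr (- 1 / 2) \<le> real N powr (- \<eta>)"
      using N by (auto simp: \<eta>_def intro!: powr_mono)
    moreover have "0 \<le> real N powr (- \<eta>)" by simp
    ultimately have "?P (Suc (Suc 0)) {Gs. red N (opinion N y Gs) \<noteq> {}} \<le> 2 * real N powr (- \<eta>)"
      by linarith
    then show "prob_blue_unanimity a b N y 2 \<ge> 1 - 2 * real N powr (- \<eta>)"
      by (simp add: prob_blue_unanimity_eq numeral_2_eq_2 del: history.simps)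
  qed
  moreover have "0 < \<eta>" using \<open>0 < \<xi>\<close> by (simp add: \<eta>_def)
  ultimately show ?thesis by blast
qed

text \<open>
  Even with a slight disadvantage \<open>-H\<close>, the first update leaves a red proportion \<open>\<rho> < b/(a+b)\<close>, because
  \<open>\<Phi>(-H/\<sigma>) > 0\<close>. The advantage is then linear in \<open>N\<close> and the second update brings the red proportion
  below \<open>r\<^sub>*/2\<close>. The exponent of the third update is fixed before \<open>H\<close>.
\<close>

lemma blue_unanimity_three_updates:
  assumes ab: "1 < b" "b < a"
  shows "\<exists>\<xi>>0. \<forall>H. \<forall>\<^sub>F N in sequentially. \<forall>y\<in>configs N.
    - H * (real N / sqrt (ln (real N))) \<le> weighted_advantage a b N y \<longrightarrow>
    prob_blue_unanimity a b N y 3 \<ge> 1 - 2 * real N powr (- \<xi>)"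
proof -
  define \<sigma> where "\<sigma> = sqrt (2 * a * b / (a + b))"
  have \<sigma>: "0 < \<sigma>" using ab by (simp add: \<sigma>_def)
  define r where "r = r_star a b / 2"
  have r: "0 < r" "r < r_star a b"
    using r_star_bounds[OF ab] by (auto simp: r_def)
  from prob_some_red_after_update[OF ab r] obtain \<xi> where "0 < \<xi>"
    and last: "\<forall>\<^sub>F N in sequentially. \<forall>y\<in>configs N. card (red N y) \<le> r * real N \<longrightarrow>
      measure_pmf.prob (random_graph a b N y) {G. red N (majority_update N G y) \<noteq> {}} \<le> real N powr (- \<xi>)"
    by blast
  obtain K where K: "b / (a + b) * (1 - std_normal_cdf (K / \<sigma>)) < r"
  proof -
    have "((\<lambda>x. b / (a + b) * (1 - std_normal_cdf x)) \<longlongrightarrow> b / (a + b) * (1 - 1)) at_top"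
      by (intro tendsto_intros std_normal_cdf_tendsto)
    then have "\<forall>\<^sub>F x in at_top. b / (a + b) * (1 - std_normal_cdf x) < r"
      using r by (intro order_tendstoD(2)) auto
    then have "\<exists>x. b / (a + b) * (1 - std_normal_cdf x) < r"
      by (rule eventually_happens'[OF trivial_limit_at_top_linorder])
    then obtain x where "b / (a + b) * (1 - std_normal_cdf (x * \<sigma> / \<sigma>)) < r"
      using \<sigma> by auto
    then show thesis by (rule that)
  qed
  define \<eta> where "\<eta> = min \<xi> (1 / 2)"
  have "\<forall>\<^sub>F N in sequentially. \<forall>y\<in>configs N.
    - H * (real N / sqrt (ln (real N))) \<le> weighted_advantage a b N y \<longrightarrow>
    prob_blue_unanimity a b N y 3 \<ge> 1 - 2 * real N powr (- \<eta>)" for H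
  proof -
    have "0 < std_normal_cdf (- H / \<sigma>)"
      using std_normal_cdf_strict_mono[of "- H / \<sigma> - 1" "- H / \<sigma>"] std_normal_cdf_bounds(1)[of "- H / \<sigma> - 1"]
      by simp
    then have "b / (a + b) * (1 - std_normal_cdf (- H / \<sigma>)) < b / (a + b) * 1"
      using ab by (intro mult_strict_left_mono) auto
    then have "b / (a + b) * (1 - std_normal_cdf (- H / \<sigma>)) < b / (a + b)" by simp
    from dense[OF this] obtain \<rho>
      where \<rho>: "b / (a + b) * (1 - std_normal_cdf (- H / \<sigma>)) < \<rho>" "\<rho> < b / (a + b)"
      by blast
    define \<kappa> where "\<kappa> = b - (a + b) * \<rho>"
    have \<kappa>: "0 < \<kappa>" using \<rho>(2) ab by (simp add: \<kappa>_def field_simps)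
    have ln_large: "\<forall>\<^sub>F N in sequentially. max 1 (K / \<kappa>) \<le> sqrt (ln (real N))"
      by (rule eventually_sqrt_ln_ge)
    show ?thesis
      using last prob_many_red_after_update[OF ab K[unfolded \<sigma>_def]]
        prob_many_red_after_update[OF ab \<rho>(1)[unfolded \<sigma>_def]] ln_large eventually_ge_at_top[of 1]
    proof (eventually_elim, intro ballI impI)
      fix N y
      assume last: "\<forall>y\<in>configs N. card (red N y) \<le> r * real N \<longrightarrow>
          measure_pmf.prob (random_graph a b N y) {G. red N (majority_update N G y) \<noteq> {}} \<le> real N powr (- \<xi>)"
        and second: "\<forall>y\<in>configs N. K * (real N / sqrt (ln (real N))) \<le> weighted_advantage a b N y \<longrightarrow>
          measure_pmf.prob (random_graph a b N y) {G. r * real N < card (red N (majority_update N G y))}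
            \<le> real N powr (- 1 / 2) / 2"
        and first: "\<forall>y\<in>configs N. - H * (real N / sqrt (ln (real N))) \<le> weighted_advantage a b N y \<longrightarrow>
          measure_pmf.prob (random_graph a b N y) {G. \<rho> * real N < card (red N (majority_update N G y))}
            \<le> real N powr (- 1 / 2) / 2"
        and ln_large: "max 1 (K / \<kappa>) \<le> sqrt (ln (real N))"
        and N: "1 \<le> N" and y: "y \<in> configs N"
        and adv: "- H * (real N / sqrt (ln (real N))) \<le> weighted_advantage a b N y"
      have gain: "K * (real N / sqrt (ln (real N))) \<le> weighted_advantage a b N z"
        if z: "z \<in> configs N" and few: "\<not> \<rho> * real N < card (red N z)" for z
      proof -
        have "K \<le> \<kappa> * sqrt (ln (real N))"
          using ln_large \<kappa> by (simp add: pos_divide_le_eq mult.commute)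
        then have "K / sqrt (ln (real N)) \<le> \<kappa>"
          using ln_large by (subst pos_divide_le_eq) auto
        then have "K / sqrt (ln (real N)) * real N \<le> \<kappa> * real N"
          by (intro mult_right_mono) auto
        moreover have "(a + b) * real (card (red N z)) \<le> (a + b) * (\<rho> * real N)"
          using few ab by (intro mult_left_mono) auto
        ultimately show ?thesis
          unfolding weighted_advantage_eq[OF z] \<kappa>_def by (simp add: algebra_simps)
      qed
      let ?P = "\<lambda>t. measure_pmf.prob (history a b N y t)"
      have "?P (Suc (Suc (Suc 0))) {Gs. red N (opinion N y Gs) \<noteq> {}} \<le>
          ?P (Suc (Suc 0)) {Gs. r * real N < card (red N (opinion N y Gs))} + real N powr (- \<xi>)"
        using last by (intro prob_history_Suc_le y) auto
      moreover have "?P (Suc (Suc 0)) {Gs. r * real N < card (red N (opinion N y Gs))} \<le>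
          ?P (Suc 0) {Gs. \<rho> * real N < card (red N (opinion N y Gs))} + real N powr (- 1 / 2) / 2"
        using second gain by (intro prob_history_Suc_le y) auto
      moreover have "?P (Suc 0) {Gs. \<rho> * real N < card (red N (opinion N y Gs))} \<le>
          ?P 0 {Gs. \<not> - H * (real N / sqrt (ln (real N))) \<le> weighted_advantage a b N (opinion N y Gs)}
            + real N powr (- 1 / 2) / 2"
        using first by (intro prob_history_Suc_le y) auto
      moreover have "?P 0 {Gs. \<not> - H * (real N / sqrt (ln (real N))) \<le> weighted_advantage a b N (opinion N y Gs)} = 0"
        using adv by (simp add: opinion_def measure_return_pmf)
      moreover have "real N powr (- \<xi>) \<le> real N powr (- \<eta>)" "real N powr (- 1 / 2) \<le> real N powr (- \<eta>)"
        using N by (auto simp: \<eta>_def intro!: powr_mono)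
      ultimately have "?P (Suc (Suc (Suc 0))) {Gs. red N (opinion N y Gs) \<noteq> {}} \<le> 2 * real N powr (- \<eta>)"
        by linarith
      then show "prob_blue_unanimity a b N y 3 \<ge> 1 - 2 * real N powr (- \<eta>)"
        by (simp add: prob_blue_unanimity_eq numeral_3_eq_3 del: history.simps)
    qed
  qed
  moreover have "0 < \<eta>" using \<open>0 < \<xi>\<close> by (simp add: \<eta>_def)
  ultimately show ?thesis by blast
qed

text \<open>
  Passage from bounds that are uniform over all configurations to a given sequence of initial
  configurations. The uniform bounds make the exponents independent of that sequence.
\<close>

lemma eventually_along_configs:
  fixes adv :: "nat \<Rightarrow> (nat \<Rightarrow> int) \<Rightarrow> real"
  assumes "\<forall>\<^sub>F N in sequentially. \<forall>y\<in>configs N. h N \<le> adv N y \<longrightarrow> 1 - g N \<le> P N y"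
    and "\<And>N. g N \<le> g' N"
    and "\<forall>N. y0 N \<in> configs N" "\<forall>\<^sub>F N in sequentially. adv N (y0 N) \<ge> h N"
  shows "\<forall>\<^sub>F N in sequentially. P N (y0 N) \<ge> 1 - (g' N :: real)"
  using assms(1,4)
proof eventually_elim
  case (elim N)
  then have "1 - g N \<le> P N (y0 N)" using assms(3) by blast
  then show ?case using assms(2)[of N] by linarith
qed

theorem theorem1p6:
  fixes a b :: real
  assumes "1 < b" and "b < a"
  shows
    "(\<exists>\<xi>>0. \<forall>H::real. \<exists>c>0. \<forall>y0 :: nat \<Rightarrow> nat \<Rightarrow> int.
        (\<forall>N. y0 N \<in> configs N) \<longrightarrow>
        (\<forall>\<^sub>F N in sequentially.
           weighted_advantage a b N (y0 N) \<ge> - H * (real N / sqrt (ln (real N)))) \<longrightarrow>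
        (\<forall>\<^sub>F N in sequentially.
           prob_blue_unanimity a b N (y0 N) 3
             \<ge> 1 - 2 * exp (- c * real N) - 2 * exp (- ((ln (real N))\<^sup>2))
                 - 2 * real N powr (- \<xi>)))
     \<and> (\<forall>K > K2 a b. \<exists>\<xi>>0. \<forall>y0 :: nat \<Rightarrow> nat \<Rightarrow> int.
        (\<forall>N. y0 N \<in> configs N) \<longrightarrow>
        (\<forall>\<^sub>F N in sequentially.
           weighted_advantage a b N (y0 N) \<ge> K * (real N / sqrt (ln (real N)))) \<longrightarrow>
        (\<forall>\<^sub>F N in sequentially.
           prob_blue_unanimity a b N (y0 N) 2
             \<ge> 1 - 2 * exp (- ((ln (real N))\<^sup>2)) - 2 * real N powr (- \<xi>)))
     \<and> (\<forall>r. 0 < r \<and> r < r_star a b \<longrightarrow> (\<exists>\<xi>>0. \<forall>y0 :: nat \<Rightarrow> nat \<Rightarrow> int.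
        (\<forall>N. y0 N \<in> configs N) \<longrightarrow>
        (\<forall>\<^sub>F N in sequentially.
           weighted_advantage a b N (y0 N) \<ge> (b - (a + b) * r) * real N) \<longrightarrow>
        (\<forall>\<^sub>F N in sequentially.
           prob_blue_unanimity a b N (y0 N) 1 \<ge> 1 - 2 * real N powr (- \<xi>))))"
proof (intro conjI allI impI)
  from blue_unanimity_three_updates[OF assms] obtain \<xi> where "0 < \<xi>"
    and ev: "\<And>H. \<forall>\<^sub>F N in sequentially. \<forall>y\<in>configs N.
      - H * (real N / sqrt (ln (real N))) \<le> weighted_advantage a b N y \<longrightarrow>
      prob_blue_unanimity a b N y 3 \<ge> 1 - 2 * real N powr (- \<xi>)"
    by blast
  show "\<exists>\<xi>>0. \<forall>H::real. \<exists>c>0. \<forall>y0 :: nat \<Rightarrow> nat \<Rightarrow> int.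
        (\<forall>N. y0 N \<in> configs N) \<longrightarrow>
        (\<forall>\<^sub>F N in sequentially.
           weighted_advantage a b N (y0 N) \<ge> - H * (real N / sqrt (ln (real N)))) \<longrightarrow>
        (\<forall>\<^sub>F N in sequentially.
           prob_blue_unanimity a b N (y0 N) 3
             \<ge> 1 - 2 * exp (- c * real N) - 2 * exp (- ((ln (real N))\<^sup>2))
                 - 2 * real N powr (- \<xi>))"
  proof (rule exI[of _ \<xi>], intro conjI allI, fact, rule exI[of _ 1], intro conjI allI impI)
    fix H :: real and y0 :: "nat \<Rightarrow> nat \<Rightarrow> int"
    assume "\<forall>N. y0 N \<in> configs N" "\<forall>\<^sub>F N in sequentially.
        weighted_advantage a b N (y0 N) \<ge> - H * (real N / sqrt (ln (real N)))"
    from eventually_along_configs[OF ev order_refl this]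
    show "\<forall>\<^sub>F N in sequentially. prob_blue_unanimity a b N (y0 N) 3
        \<ge> 1 - 2 * exp (- 1 * real N) - 2 * exp (- ((ln (real N))\<^sup>2)) - 2 * real N powr (- \<xi>)"
    proof eventually_elim
      case (elim N)
      then show ?case
        using exp_ge_zero[of "- 1 * real N"] exp_ge_zero[of "- ((ln (real N))\<^sup>2)"] by linarith
    qed
  qed simp
next
  fix K assume "K2 a b < K"
  from blue_unanimity_two_updates[OF assms this] obtain \<xi> where "0 < \<xi>"
    and ev: "\<forall>\<^sub>F N in sequentially. \<forall>y\<in>configs N.
      K * (real N / sqrt (ln (real N))) \<le> weighted_advantage a b N y \<longrightarrow>
      prob_blue_unanimity a b N y 2 \<ge> 1 - 2 * real N powr (- \<xi>)"
    by blast
  show "\<exists>\<xi>>0. \<forall>y0 :: nat \<Rightarrow> nat \<Rightarrow> int.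
        (\<forall>N. y0 N \<in> configs N) \<longrightarrow>
        (\<forall>\<^sub>F N in sequentially.
           weighted_advantage a b N (y0 N) \<ge> K * (real N / sqrt (ln (real N)))) \<longrightarrow>
        (\<forall>\<^sub>F N in sequentially.
           prob_blue_unanimity a b N (y0 N) 2
             \<ge> 1 - 2 * exp (- ((ln (real N))\<^sup>2)) - 2 * real N powr (- \<xi>))"
  proof (intro exI[of _ \<xi>] conjI allI impI)
    fix y0 :: "nat \<Rightarrow> nat \<Rightarrow> int"
    assume "\<forall>N. y0 N \<in> configs N" "\<forall>\<^sub>F N in sequentially.
        weighted_advantage a b N (y0 N) \<ge> K * (real N / sqrt (ln (real N)))"
    from eventually_along_configs[OF ev order_refl this]
    show "\<forall>\<^sub>F N in sequentially. prob_blue_unanimity a b N (y0 N) 2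
        \<ge> 1 - 2 * exp (- ((ln (real N))\<^sup>2)) - 2 * real N powr (- \<xi>)"
    proof eventually_elim
      case (elim N)
      then show ?case
        using exp_ge_zero[of "- ((ln (real N))\<^sup>2)"] by linarith
    qed
  qed (use \<open>0 < \<xi>\<close> in auto)
next
  fix r assume "0 < r \<and> r < r_star a b"
  then obtain \<xi> where "0 < \<xi>"
    and ev: "\<forall>\<^sub>F N in sequentially. \<forall>y\<in>configs N.
      (b - (a + b) * r) * real N \<le> weighted_advantage a b N y \<longrightarrow>
      prob_blue_unanimity a b N y 1 \<ge> 1 - real N powr (- \<xi>)"
    using blue_unanimity_one_update[OF assms] by blast
  show "\<exists>\<xi>>0. \<forall>y0 :: nat \<Rightarrow> nat \<Rightarrow> int.
        (\<forall>N. y0 N \<in> configs N) \<longrightarrow>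
        (\<forall>\<^sub>F N in sequentially.
           weighted_advantage a b N (y0 N) \<ge> (b - (a + b) * r) * real N) \<longrightarrow>
        (\<forall>\<^sub>F N in sequentially.
           prob_blue_unanimity a b N (y0 N) 1 \<ge> 1 - 2 * real N powr (- \<xi>))"
  proof (intro exI[of _ \<xi>] conjI allI impI)
    fix y0 :: "nat \<Rightarrow> nat \<Rightarrow> int"
    assume y0: "\<forall>N. y0 N \<in> configs N" "\<forall>\<^sub>F N in sequentially.
        weighted_advantage a b N (y0 N) \<ge> (b - (a + b) * r) * real N"
    show "\<forall>\<^sub>F N in sequentially. prob_blue_unanimity a b N (y0 N) 1 \<ge> 1 - 2 * real N powr (- \<xi>)"
      by (rule eventually_along_configs[OF ev _ y0]) simp
  qed (use \<open>0 < \<xi>\<close> in auto)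
qed

end
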